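(* Let $w:\overline\Omega_L\to[0,\infty)$ be measurable with $w=0$ on $\Delta_L$ and $w>0$ on $\Omega_L$, and suppose $0<\mu_D^w(\overline\Omega_L)<\infty$ almost surely. Assume the following. (1) $K_Z:\mathbb R^d\to[0,\infty)$ and $K_U:\mathbb R^2\to[0,\infty)$ are bounded, Lipschitz, integrate to one, are supported in the closed unit balls of $\mathbb R^d$ and $\mathbb R^2$ respectively, and there are $\rho_{K,Z},\rho_{K,U},k_Z,k_U>0$ with $K_Z(x)\ge k_Z$ whenever $\|x\|\le\rho_{K,Z}$ and $K_U(y)\ge k_U$ whenever $\|y\|\le\rho_{K,U}$. The positive bandwidths $h_Z=h_{Z,n}$, $h_U=h_{U,n}$ satisfy $h_Z\to0$, $h_U\to0$ and $nh_Z^dh_U^2/\log n\to\infty$. (2) $\mathcal Z\subset\mathbb R^d$ is compact and there are $\rho_Z,\eta_Z>0$ such that for every $z\in\mathcal Z$ there is a unit vector $\xi_z$ with $\{z+tv:0<t<\rho_Z,\ \|v\|=1,\ \|v-\xi_z\|<\eta_Z\}\subset\mathcal Z$. (3) The law of $Z$ has a density $p_Z$ on $\mathcal Z$ with $0<c_Z\le p_Z(z)\le C_Z<\infty$ for all $z\in\mathcal Z$. (4) The normalized conditional mean measure $\widetilde\Lambda_z^w$ has a Lebesgue density $\widetilde\lambda_w(z,u)$ on $\overline\Omega_L$, and $\widetilde\lambda_w$ is bounded and uniformly continuous on $\mathcal Z\times\overline\Omega_L$. Then there is $C<\infty$, depending only on the fixed model quantities, such that, for every $\delta\in(0,1)$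 and all sufficiently large $n$, with probability at least $1-\delta$, $$\sup_{z\in\mathcal Z,u\in\overline\Omega_L}\bigl|\widehat{\widetilde\lambda}_{w,n}(z,u)-\widetilde\lambda_w(z,u)\bigr|\le C\left\{\omega_{\widetilde\lambda_w}(h_Z+h_U)+r_n(h_Z,h_U,\delta)\right\},$$ where $$r_n(h_Z,h_U,\delta)=\sqrt{\frac{\log(Cn/(\delta h_Z^dh_U^2))}{nh_Z^dh_U^2}}+\frac{\log(Cn/(\delta h_Z^dh_U^2))}{nh_Z^dh_U^2}.$$ Consequently, the left-hand side converges to zero in probability.
   Context: Fix $L>0$ and let $\Omega_L=\{(b,t):0\le b<t\le L\}$, $\overline\Omega_L=\{(b,t):0\le b\le t\le L\}$, $\Delta_L=\{(b,b):0\le b\le L\}$. $\|\cdot\|$ is the Euclidean norm. A persistence diagram $D$ supported in $\Omega_L$ is identified with a locally finite counting measure $\mu_D=\sum_{x\in D}a_x\delta_x$, $a_x\in\mathbb N$; $\mu_D^w(A)=\int_Aw\,d\mu_D$ for Borel $A\subseteq\overline\Omega_L$. $(Z_i,D_i)$, $i=1,\dots,n$, are i.i.d. copies of $(Z,D)$, with $Z\in\mathcal Z\subset\mathbb R^d$ and $D$ a random persistence diagram. Normalized weighted measures: $\widetilde\mu_D^w=\mu_D^w/\mu_D^w(\overline\Omega_L)$, $\widetilde\mu_i^w=\widetilde\mu_{D_i}^w$, $\widetilde\Lambda_z^w(A)=\mathbb E[\widetilde\mu_D^w(A)\mid Z=z]=\int_A\widetilde\lambda_w(z,u)\,du$. For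 $h>0$ define $c_{Z,h}(z)=\int_{\mathcal Z}h^{-d}K_Z((z'-z)/h)\,dz'$, $c_{U,h}(u)=\int_{\overline\Omega_L}h^{-2}K_U((v-u)/h)\,dv$, $\kappa_{Z,h}(z,z')=h^{-d}K_Z((z'-z)/h)/c_{Z,h}(z)$, $\kappa_{U,h}(u,v)=h^{-2}K_U((v-u)/h)/c_{U,h}(u)$. Set $\widetilde Y_{i,h_U}(u)=\int_{\overline\Omega_L}\kappa_{U,h_U}(u,v)\,d\widetilde\mu_i^w(v)$ and $$\widehat{\widetilde\lambda}_{w,n}(z,u)=\frac{\sum_{i=1}^n\kappa_{Z,h_Z}(z,Z_i)\widetilde Y_{i,h_U}(u)}{\sum_{i=1}^n\kappa_{Z,h_Z}(z,Z_i)},$$ with value zero when the denominator is zero. Modulus of continuity: $\omega_{\widetilde\lambda_w}(r)=\sup\{|\widetilde\lambda_w(z,u)-\widetilde\lambda_w(z',u')|:\|z-z'\|+\|u-u'\|\le r\}$. *)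

theory Defs
  imports "HOL-Probability.Probability"
begin

definition Omega :: "real \<Rightarrow> (real \<times> real) set" where
  "Omega L = {(b, t). 0 \<le> b \<and> b < t \<and> t \<le> L}"

definition Omega_bar :: "real \<Rightarrow> (real \<times> real) set" where
  "Omega_bar L = {(b, t). 0 \<le> b \<and> b \<le> t \<and> t \<le> L}"

definition Delta :: "real \<Rightarrow> (real \<times> real) set" where
  "Delta L = {(b, b) | b. 0 \<le> b \<and> b \<le> L}"

text \<open>A diagram is represented by its multiplicity function. Local finiteness refers to the
  space \<open>Omega L\<close>: infinitely many points may accumulate at the diagonal.\<close>

type_synonym diagram = "real \<times> real \<Rightarrow> nat"

definition persistence_diagrams :: "real \<Rightarrow> diagram set" where
  "persistence_diagrams L =
     {a. {x. a x \<noteq> 0} \<subseteq> Omega L \<and>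
         (\<forall>K. compact K \<and> K \<subseteq> Omega L \<longrightarrow> finite {x \<in> K. a x \<noteq> 0})}"

definition diagram_measure :: "real \<Rightarrow> diagram \<Rightarrow> (real \<times> real) measure" where
  "diagram_measure L a =
     distr (density (count_space (Omega_bar L)) (\<lambda>x. of_nat (a x)))
       (restrict_space borel (Omega_bar L)) (\<lambda>x. x)"

text \<open>The usual sigma-algebra of point processes, generated by the counting maps
  \<open>a \<mapsto> \<mu>\<^sub>a(A)\<close> with \<open>A\<close> Borel.\<close>

definition diagram_space :: "real \<Rightarrow> diagram measure" where
  "diagram_space L = sigma (persistence_diagrams L)
     {{a \<in> persistence_diagrams L. emeasure (diagram_measure L a) A \<in> B} | A B.
        A \<in> sets (restrict_space borel (Omega_bar L)) \<and> B \<in> sets borel}"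

definition weighted_measure ::
  "real \<Rightarrow> (real \<times> real \<Rightarrow> real) \<Rightarrow> diagram \<Rightarrow> (real \<times> real) measure" where
  "weighted_measure L w a = density (diagram_measure L a) (\<lambda>x. ennreal (w x))"

text \<open>With the conventions of \<^typ>\<open>ennreal\<close> this is the zero measure if the total mass is
  \<open>0\<close> or \<open>\<infinity>\<close>.\<close>

definition normalized_measure ::
  "real \<Rightarrow> (real \<times> real \<Rightarrow> real) \<Rightarrow> diagram \<Rightarrow> (real \<times> real) measure" where
  "normalized_measure L w a =
     scale_measure (1 / emeasure (weighted_measure L w a) (Omega_bar L)) (weighted_measure L w a)"

text \<open>\<open>\<Lambda> z\<close> is a version of \<open>A \<mapsto> E[X(A) | Z = z]\<close> for a random measure \<open>X\<close> on the measurable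
  space \<open>N\<close>, i.e. \<open>\<Lambda> (Z \<omega>) A\<close> is a version of \<open>E[X(A) | \<sigma>(Z)]\<close> for every \<open>A\<close>.\<close>

definition conditional_mean_measure ::
  "'p measure \<Rightarrow> 'u measure \<Rightarrow> ('p \<Rightarrow> 'z::topological_space) \<Rightarrow> ('p \<Rightarrow> 'u measure) \<Rightarrow>
   ('z \<Rightarrow> 'u measure) \<Rightarrow> bool" where
  "conditional_mean_measure P N Z X \<Lambda> \<longleftrightarrow>
     (\<forall>A \<in> sets N. AE \<omega> in P.
        real_cond_exp P (vimage_algebra (space P) Z borel) (\<lambda>\<omega>'. measure (X \<omega>') A) \<omega>
          = measure (\<Lambda> (Z \<omega>)) A)"

definition iid_copies ::
  "'p measure \<Rightarrow> 'x measure \<Rightarrow> ('p \<Rightarrow> 'x) \<Rightarrow> 'm measure \<Rightarrow> (nat \<Rightarrow> 'm \<Rightarrow> 'x) \<Rightarrow> bool" where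
  "iid_copies P S X M Xs \<longleftrightarrow>
     prob_space M \<and> prob_space.indep_vars M (\<lambda>_. S) Xs {1..} \<and>
     (\<forall>i\<ge>1. distr M S (Xs i) = distr P S X)"

definition smoothing_kernel ::
  "('a::euclidean_space \<Rightarrow> real) \<Rightarrow> real \<Rightarrow> real \<Rightarrow> bool" where
  "smoothing_kernel K \<rho> k \<longleftrightarrow>
     (\<forall>x. 0 \<le> K x) \<and> bounded (range K) \<and> (\<exists>B. B-lipschitz_on UNIV K) \<and>
     has_bochner_integral lborel K 1 \<and>
     closure {x. K x \<noteq> 0} \<subseteq> cball 0 1 \<and>
     0 < \<rho> \<and> 0 < k \<and> (\<forall>x. norm x \<le> \<rho> \<longrightarrow> k \<le> K x)"

text \<open>The boundary normalization \<open>c\<^sub>h\<close> and the normalized kernel \<open>\<kappa>\<^sub>h\<close> on a domain \<open>S\<close>;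
  these are used both for the covariate domain and for \<open>Omega_bar L\<close>.\<close>

definition boundary_mass ::
  "'a::euclidean_space set \<Rightarrow> ('a \<Rightarrow> real) \<Rightarrow> real \<Rightarrow> 'a \<Rightarrow> real" where
  "boundary_mass S K h x = (LINT y:S|lborel. K ((y - x) /\<^sub>R h) / h ^ DIM('a))"

definition boundary_kernel ::
  "'a::euclidean_space set \<Rightarrow> ('a \<Rightarrow> real) \<Rightarrow> real \<Rightarrow> 'a \<Rightarrow> 'a \<Rightarrow> real" where
  "boundary_kernel S K h x y = K ((y - x) /\<^sub>R h) / h ^ DIM('a) / boundary_mass S K h x"

definition smoothed_diagram ::
  "real \<Rightarrow> (real \<times> real \<Rightarrow> real) \<Rightarrow> (real \<times> real \<Rightarrow> real) \<Rightarrow> real \<Rightarrow> diagram \<Rightarrow>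
   real \<times> real \<Rightarrow> real" where
  "smoothed_diagram L w KU hU a u =
     (LINT v|normalized_measure L w a. boundary_kernel (Omega_bar L) KU hU u v)"

text \<open>The value is \<open>0\<close> when the denominator vanishes, by division by zero.\<close>

definition intensity_estimator ::
  "real \<Rightarrow> (real \<times> real \<Rightarrow> real) \<Rightarrow> (real^'d) set \<Rightarrow> (real^'d \<Rightarrow> real) \<Rightarrow>
   (real \<times> real \<Rightarrow> real) \<Rightarrow> real \<Rightarrow> real \<Rightarrow> nat \<Rightarrow> (nat \<Rightarrow> real^'d) \<Rightarrow> (nat \<Rightarrow> diagram) \<Rightarrow>
   real^'d \<Rightarrow> real \<times> real \<Rightarrow> real" where
  "intensity_estimator L w \<Z> KZ KU hZ hU n zs as z u =
     (\<Sum>i=1..n. boundary_kernel \<Z> KZ hZ z (zs i) * smoothed_diagram L w KU hU (as i) u) /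
     (\<Sum>i=1..n. boundary_kernel \<Z> KZ hZ z (zs i))"

text \<open>The supremum is taken in \<^typ>\<open>ereal\<close>, so that it is meaningful without a
  boundedness side condition.\<close>

definition sup_error ::
  "'a set \<Rightarrow> 'b set \<Rightarrow> ('a \<Rightarrow> 'b \<Rightarrow> real) \<Rightarrow> ('a \<Rightarrow> 'b \<Rightarrow> real) \<Rightarrow> ereal" where
  "sup_error A B f g = (SUP (z, u) \<in> A \<times> B. ereal \<bar>f z u - g z u\<bar>)"

definition modulus ::
  "'a::real_normed_vector set \<Rightarrow> 'b::real_normed_vector set \<Rightarrow> ('a \<Rightarrow> 'b \<Rightarrow> real) \<Rightarrow>
   real \<Rightarrow> real" where
  "modulus A B f r =
     Sup {\<bar>f z u - f z' u'\<bar> | z u z' u'.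
       z \<in> A \<and> z' \<in> A \<and> u \<in> B \<and> u' \<in> B \<and> norm (z - z') + norm (u - u') \<le> r}"

definition bandwidths :: "nat \<Rightarrow> (nat \<Rightarrow> real) \<Rightarrow> (nat \<Rightarrow> real) \<Rightarrow> bool" where
  "bandwidths d hZ hU \<longleftrightarrow>
     (\<forall>n\<ge>1. 0 < hZ n \<and> 0 < hU n) \<and> hZ \<longlonglongrightarrow> 0 \<and> hU \<longlonglongrightarrow> 0 \<and>
     filterlim (\<lambda>n. real n * hZ n ^ d * hU n ^ 2 / ln (real n)) at_top sequentially"

definition rate :: "real \<Rightarrow> nat \<Rightarrow> nat \<Rightarrow> real \<Rightarrow> real \<Rightarrow> real \<Rightarrow> real" where
  "rate C d n hZ hU \<delta> =
     (let N = real n * hZ ^ d * hU ^ 2;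
          l = ln (C * real n / (\<delta> * hZ ^ d * hU ^ 2))
      in sqrt (l / N) + l / N)"

end

theory Submission
  imports Defs
begin

text \<open>
  The estimator is a ratio \<open>G / S\<close> of two averages of i.i.d. terms: \<open>S\<close> averages the covariate kernel
  at \<open>Z\<^sub>i\<close>, and \<open>G\<close> averages its product with the smoothed diagram. Three facts give the theorem.

  \<^item> \<^emph>\<open>The boundary normalization is harmless.\<close> Both domains contain, near each of their points and at every
    small scale, a ball of comparable size (\<open>interior_balls\<close>): for the covariates by the cone
    condition, for the triangle of birth-death pairs by convexity. The normalizing masses are
    therefore bounded below, and the normalized kernels are bounded by \<open>A / h\<^sup>d\<close>, Lipschitz with a
    constant polynomial in \<open>1 / h\<close>, supported in balls of radius \<open>h\<close>, and of integral \<open>1\<close>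
    (\<open>kernel_bounds_exist\<close>).

  \<^item> \<^emph>\<open>The bias is controlled by the modulus of continuity.\<close> Conditioning on the covariate turns the expectation of
    \<open>G\<close> into a kernel average of the intensity (\<open>conditional_mean_nn_integral\<close>). Both kernels being
    local, this average differs from \<open>lam z u\<close> times the expectation of \<open>S\<close> by at most \<open>CZ\<close> times the
    modulus at \<open>hZ + hU\<close> (\<open>bias_le_modulus\<close>), while the expectation of \<open>S\<close> is at least \<open>cZ\<close>.

  \<^item> \<^emph>\<open>The stochastic error is of the order of the rate.\<close> With \<open>b = hZ\<^sup>d hU\<^sup>2\<close>, the summands and their
    second moments are of order \<open>1 / b\<close>, so Bernstein's inequality yields deviations of order
    \<open>sqrt (l / (n b))\<close> outside an event of probability \<open>exp (- c l)\<close>. Only polynomially many (in \<open>n\<close>)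
    points \<open>(z, u)\<close> need to be considered, because the kernels are Lipschitz and the bandwidths are
    eventually at least \<open>1 / n\<close>; the logarithm \<open>l\<close> in the rate pays for the union bound
    (\<open>kernel_averages_deviation\<close>).

  The decomposition \<open>ratio_error\<close> combines the three. Convergence in probability follows since the
  rate and the modulus tend to \<open>0\<close> for each fixed level \<open>\<delta>\<close>.
\<close>

section \<open>Bernstein's inequality and uniform deviations\<close>

text \<open>For negative arguments the bound follows from the quadratic Taylor lower bound at \<open>- x\<close> by
  taking reciprocals: \<open>(1 - y + y\<^sup>2) (1 + y + y\<^sup>2 / 2) \<ge> 1\<close> for \<open>y \<ge> 0\<close>.\<close>

lemma exp_le_quadratic:
  fixes x :: real
  assumes "\<bar>x\<bar> \<le> 1"
  shows "exp x \<le> 1 + x + x\<^sup>2"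
proof (cases "0 \<le> x")
  case True
  then show ?thesis using assms by (intro exp_bound) auto
next
  case False
  define y where "y = - x"
  have y: "0 \<le> y" "y \<le> 1" using False assms by (auto simp: y_def)
  have pos: "0 < 1 - y + y\<^sup>2" using y by (cases "y = 1") (auto intro: add_pos_nonneg)
  have "(1 - y + y\<^sup>2) * (1 + y + y\<^sup>2 / 2) = 1 + (y\<^sup>2 + y ^ 3 + y ^ 4) / 2"
    by (simp add: field_simps power2_eq_square power3_eq_cube power4_eq_xxxx)
  then have "1 \<le> (1 - y + y\<^sup>2) * (1 + y + y\<^sup>2 / 2)" using y by simp
  also have "\<dots> \<le> (1 - y + y\<^sup>2) * exp y"
    using exp_lower_Taylor_quadratic[OF y(1)] pos by (intro mult_left_mono) auto
  finally have "exp (- y) \<le> 1 - y + y\<^sup>2" by (simp add: exp_minus field_simps)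
  then show ?thesis by (simp add: y_def)
qed

text \<open>The exponential Markov inequality, with the moment generating function bounded by
  \<open>E exp (s X) \<le> 1 + s m + s\<^sup>2 v \<le> exp (s m + s\<^sup>2 v)\<close>. The raw second moment suffices, because the
  factor \<open>exp (s m)\<close> is cancelled by the shift of the threshold by \<open>m\<close>. The parameter \<open>s\<close> stays free
  so that it can be tuned to the deviation of interest.\<close>

lemma (in prob_space) bernstein_upper_tail:
  fixes X :: "nat \<Rightarrow> 'a \<Rightarrow> real"
  assumes ind: "indep_vars (\<lambda>_. borel) X {1..n}"
    and bdd: "\<And>i \<omega>. i \<in> {1..n} \<Longrightarrow> \<omega> \<in> space M \<Longrightarrow> \<bar>X i \<omega>\<bar> \<le> B"
    and mean: "\<And>i. i \<in> {1..n} \<Longrightarrow> expectation (X i) = m"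
    and second: "\<And>i. i \<in> {1..n} \<Longrightarrow> expectation (\<lambda>\<omega>. (X i \<omega>)\<^sup>2) \<le> v"
    and s: "0 < s" "s * B \<le> 1"
  shows "prob {\<omega> \<in> space M. n * (m + \<epsilon>) \<le> (\<Sum>i=1..n. X i \<omega>)} \<le> exp (n * (s\<^sup>2 * v - s * \<epsilon>))"
proof -
  have rv: "random_variable borel (X i)" if "i \<in> {1..n}" for i
    using ind that by (auto simp: indep_vars_def)
  have le1: "\<bar>s * X i \<omega>\<bar> \<le> 1" if "i \<in> {1..n}" "\<omega> \<in> space M" for i \<omega>
  proof -
    have "\<bar>s * X i \<omega>\<bar> \<le> s * B"
      using bdd[OF that] s by (simp add: abs_mult)
    then show ?thesis using s by simp
  qed
  have int: "integrable M (X i)" if "i \<in> {1..n}" for i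
    using rv[OF that] bdd[OF that] by (intro integrable_const_bound[where B = B]) auto
  have int2: "integrable M (\<lambda>\<omega>. (X i \<omega>)\<^sup>2)" if "i \<in> {1..n}" for i
  proof (intro integrable_const_bound[where B = "B\<^sup>2"] AE_I2)
    fix \<omega> assume "\<omega> \<in> space M"
    then have "\<bar>X i \<omega>\<bar>\<^sup>2 \<le> B\<^sup>2" using bdd[OF that] by (intro power_mono) auto
    then show "norm ((X i \<omega>)\<^sup>2) \<le> B\<^sup>2" by simp
  qed (use rv[OF that] in measurable)
  have intexp: "integrable M (\<lambda>\<omega>. exp (s * X i \<omega>))" if "i \<in> {1..n}" for i
    using rv[OF that] le1[OF that]
    by (intro integrable_const_bound[where B = "exp 1"] AE_I2) (auto simp: abs_le_iff)
  have mgf: "expectation (\<lambda>\<omega>. exp (s * X i \<omega>)) \<le> exp (s * m + s\<^sup>2 * v)" if i: "i \<in> {1..n}" for i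
  proof -
    have "expectation (\<lambda>\<omega>. exp (s * X i \<omega>)) \<le> expectation (\<lambda>\<omega>. 1 + s * X i \<omega> + s\<^sup>2 * (X i \<omega>)\<^sup>2)"
      using exp_le_quadratic[OF le1[OF i]] int[OF i] int2[OF i] intexp[OF i]
      by (intro integral_mono) (auto simp: power_mult_distrib)
    also have "\<dots> = 1 + s * m + s\<^sup>2 * expectation (\<lambda>\<omega>. (X i \<omega>)\<^sup>2)"
      using int[OF i] int2[OF i] mean[OF i] by (simp add: prob_space)
    also have "\<dots> \<le> 1 + (s * m + s\<^sup>2 * v)"
      using second[OF i] by (simp add: mult_left_mono)
    also have "\<dots> \<le> exp (s * m + s\<^sup>2 * v)" by (rule exp_ge_add_one_self)
    finally show ?thesis .
  qed
  have indexp: "indep_vars (\<lambda>_. borel) (\<lambda>i \<omega>. exp (s * X i \<omega>)) {1..n}"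
    by (rule indep_vars_compose2[OF ind]) measurable
  have exp_sum: "exp (s * (\<Sum>i=1..n. X i \<omega>)) = (\<Prod>i=1..n. exp (s * X i \<omega>))" for \<omega>
    by (simp add: sum_distrib_left exp_sum)
  have intprod: "integrable M (\<lambda>\<omega>. exp (s * (\<Sum>i=1..n. X i \<omega>)))"
    unfolding exp_sum using intexp by (intro indep_vars_integrable[OF _ indexp]) auto
  have "expectation (\<lambda>\<omega>. exp (s * (\<Sum>i=1..n. X i \<omega>))) = (\<Prod>i=1..n. expectation (\<lambda>\<omega>. exp (s * X i \<omega>)))"
    unfolding exp_sum using intexp by (intro indep_vars_lebesgue_integral[OF _ indexp]) auto
  also have "\<dots> \<le> (\<Prod>i=1..n. exp (s * m + s\<^sup>2 * v))"
    using mgf by (intro prod_mono) auto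
  also have "\<dots> = exp (n * (s * m + s\<^sup>2 * v))" by (simp add: exp_of_nat_mult)
  finally have mgf_sum: "expectation (\<lambda>\<omega>. exp (s * (\<Sum>i=1..n. X i \<omega>))) \<le> exp (n * (s * m + s\<^sup>2 * v))" .
  have "prob {\<omega> \<in> space M. n * (m + \<epsilon>) \<le> (\<Sum>i=1..n. X i \<omega>)}
      \<le> exp (- s * (n * (m + \<epsilon>))) * expectation (\<lambda>\<omega>. exp (s * (\<Sum>i=1..n. X i \<omega>)))"
    using Chernoff_ineq_ge[OF s(1), of "space M" "\<lambda>\<omega>. \<Sum>i=1..n. X i \<omega>" "n * (m + \<epsilon>)",
        unfolded set_integrable_def] integrable_mult_indicator[OF sets.top intprod]
    unfolding set_integral_space[OF intprod] by auto
  also have "\<dots> \<le> exp (- s * (n * (m + \<epsilon>))) * exp (n * (s * m + s\<^sup>2 * v))"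
    using mgf_sum by (intro mult_left_mono) auto
  also have "\<dots> = exp (n * (s\<^sup>2 * v - s * \<epsilon>))"
    by (simp add: exp_add[symmetric] algebra_simps)
  finally show ?thesis .
qed

lemma (in prob_space) bernstein_two_sided:
  fixes X :: "nat \<Rightarrow> 'a \<Rightarrow> real"
  assumes ind: "indep_vars (\<lambda>_. borel) X {1..n}"
    and bdd: "\<And>i \<omega>. i \<in> {1..n} \<Longrightarrow> \<omega> \<in> space M \<Longrightarrow> \<bar>X i \<omega>\<bar> \<le> B"
    and mean: "\<And>i. i \<in> {1..n} \<Longrightarrow> expectation (X i) = m"
    and second: "\<And>i. i \<in> {1..n} \<Longrightarrow> expectation (\<lambda>\<omega>. (X i \<omega>)\<^sup>2) \<le> v"
    and s: "0 < s" "s * B \<le> 1"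
  shows "prob {\<omega> \<in> space M. n * \<epsilon> \<le> \<bar>(\<Sum>i=1..n. X i \<omega>) - n * m\<bar>}
           \<le> 2 * exp (n * (s\<^sup>2 * v - s * \<epsilon>))"
proof -
  have rv [measurable]: "random_variable borel (X i)" if "i \<in> {1..n}" for i
    using ind that by (auto simp: indep_vars_def)
  let ?U = "{\<omega> \<in> space M. n * (m + \<epsilon>) \<le> (\<Sum>i=1..n. X i \<omega>)}"
  let ?L = "{\<omega> \<in> space M. n * (- m + \<epsilon>) \<le> (\<Sum>i=1..n. - X i \<omega>)}"
  have "{\<omega> \<in> space M. n * \<epsilon> \<le> \<bar>(\<Sum>i=1..n. X i \<omega>) - n * m\<bar>} \<subseteq> ?U \<union> ?L"
    by (auto simp: sum_negf algebra_simps abs_if split: if_splits)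
  then have "prob {\<omega> \<in> space M. n * \<epsilon> \<le> \<bar>(\<Sum>i=1..n. X i \<omega>) - n * m\<bar>} \<le> prob (?U \<union> ?L)"
    by (rule finite_measure_mono) measurable
  also have "\<dots> \<le> prob ?U + prob ?L"
    by (rule measure_Un_le) measurable
  also have "prob ?U \<le> exp (n * (s\<^sup>2 * v - s * \<epsilon>))"
    by (rule bernstein_upper_tail[OF ind bdd mean second s])
  also have "prob ?L \<le> exp (n * (s\<^sup>2 * v - s * \<epsilon>))"
  proof (rule bernstein_upper_tail[of "\<lambda>i \<omega>. - X i \<omega>" n B "- m" v s])
    show "indep_vars (\<lambda>_. borel) (\<lambda>i \<omega>. - X i \<omega>) {1..n}"
      by (rule indep_vars_compose2[OF ind]) measurable
  qed (use bdd mean second s in auto)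
  finally show ?thesis by simp
qed

text \<open>The union bound over a finite net \<open>T\<close>. Replacing \<open>f\<close> by a neighbour in the net costs \<open>\<eta>\<close> in the
  empirical mean and once more \<open>\<eta>\<close> in the expectation. The good event only involves the net, so that
  the supremum over \<open>F\<close> need not be measurable.\<close>

lemma (in prob_space) uniform_deviation:
  fixes \<xi> :: "nat \<Rightarrow> 'a \<Rightarrow> 'x" and F T :: "('x \<Rightarrow> real) set"
  assumes ind: "indep_vars (\<lambda>_. S) \<xi> {1..n}"
    and law: "\<And>i. i \<in> {1..n} \<Longrightarrow> distr M S (\<xi> i) = Q"
    and meas: "\<And>f. f \<in> F \<Longrightarrow> f \<in> borel_measurable S"
    and bdd: "\<And>f x. f \<in> F \<Longrightarrow> x \<in> space S \<Longrightarrow> \<bar>f x\<bar> \<le> B"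
    and second: "\<And>f. f \<in> F \<Longrightarrow> (\<integral>x. (f x)\<^sup>2 \<partial>Q) \<le> v"
    and net: "finite T" "T \<subseteq> F"
      "\<And>f. f \<in> F \<Longrightarrow> \<exists>g\<in>T. \<forall>x\<in>space S. \<bar>f x - g x\<bar> \<le> \<eta>"
    and s: "0 < s" "s * B \<le> 1" and n: "0 < n"
  shows "\<exists>E\<in>events. 1 - 2 * card T * exp (n * (s\<^sup>2 * v - s * \<epsilon>)) \<le> prob E \<and>
    (\<forall>\<omega>\<in>E. \<omega> \<in> space M \<and> (\<forall>f\<in>F. \<bar>(\<Sum>i=1..n. f (\<xi> i \<omega>)) / n - (\<integral>x. f x \<partial>Q)\<bar> \<le> \<epsilon> + 2 * \<eta>))"
proof -
  let ?m = "\<lambda>f. \<integral>x. f x \<partial>Q"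
  have \<xi> [measurable]: "random_variable S (\<xi> i)" if "i \<in> {1..n}" for i
    using ind that by (auto simp: indep_vars_def)
  have \<xi>S: "\<xi> i \<omega> \<in> space S" if "i \<in> {1..n}" "\<omega> \<in> space M" for i \<omega>
    using \<xi>[OF that(1)] that(2) by (rule measurable_space)
  have one: "1 \<in> {1..n}" using n by simp
  have Q: "prob_space Q" "sets Q = sets S"
    using prob_space_distr[OF \<xi>[OF one]] law[OF one] by auto
  interpret Q: prob_space Q by (rule Q)
  have spQ: "space Q = space S" using Q(2) by (rule sets_eq_imp_space_eq)
  define Bad where "Bad f = {\<omega> \<in> space M. n * \<epsilon> \<le> \<bar>(\<Sum>i=1..n. f (\<xi> i \<omega>)) - n * ?m f\<bar>}" for f
  have Bad_ev: "Bad f \<in> events" if "f \<in> F" for f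
    unfolding Bad_def using meas[OF that] by measurable
  have Bad_le: "prob (Bad f) \<le> 2 * exp (n * (s\<^sup>2 * v - s * \<epsilon>))" if f: "f \<in> F" for f
    unfolding Bad_def
  proof (rule bernstein_two_sided[where B = B])
    have [measurable]: "f \<in> borel_measurable S" by (rule meas[OF f])
    show "indep_vars (\<lambda>_. borel) (\<lambda>i \<omega>. f (\<xi> i \<omega>)) {1..n}"
      by (rule indep_vars_compose2[OF ind]) measurable
    show "expectation (\<lambda>\<omega>. f (\<xi> i \<omega>)) = ?m f" if i: "i \<in> {1..n}" for i
      using law[OF i] \<xi>[OF i] integral_distr[of "\<xi> i" M S f] by simp
    show "expectation (\<lambda>\<omega>. (f (\<xi> i \<omega>))\<^sup>2) \<le> v" if i: "i \<in> {1..n}" for i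
      using law[OF i] \<xi>[OF i] integral_distr[of "\<xi> i" M S "\<lambda>x. (f x)\<^sup>2"] second[OF f] by simp
  qed (use bdd[OF f] \<xi>S s in auto)
  define E where "E = space M - (\<Union>f\<in>T. Bad f)"
  have U_ev: "(\<Union>f\<in>T. Bad f) \<in> events" using net Bad_ev by (intro sets.finite_UN) auto
  have "prob (\<Union>f\<in>T. Bad f) \<le> (\<Sum>f\<in>T. prob (Bad f))"
    using net Bad_ev by (intro finite_measure_subadditive_finite) auto
  also have "\<dots> \<le> (\<Sum>f\<in>T. 2 * exp (n * (s\<^sup>2 * v - s * \<epsilon>)))"
    using net Bad_le by (intro sum_mono) auto
  finally have "1 - 2 * card T * exp (n * (s\<^sup>2 * v - s * \<epsilon>)) \<le> prob E"
    unfolding E_def using prob_compl[OF U_ev] by simp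
  moreover have "\<bar>(\<Sum>i=1..n. f (\<xi> i \<omega>)) / n - ?m f\<bar> \<le> \<epsilon> + 2 * \<eta>" if \<omega>: "\<omega> \<in> E" and f: "f \<in> F" for \<omega> f
  proof -
    obtain g where g: "g \<in> T" "\<And>x. x \<in> space S \<Longrightarrow> \<bar>f x - g x\<bar> \<le> \<eta>" using net(3)[OF f] by blast
    have gF: "g \<in> F" using g net by auto
    have \<omega>M: "\<omega> \<in> space M" and "\<omega> \<notin> Bad g" using \<omega> g by (auto simp: E_def)
    then have "\<bar>(\<Sum>i=1..n. g (\<xi> i \<omega>)) - n * ?m g\<bar> \<le> n * \<epsilon>" by (auto simp: Bad_def)
    moreover have "(\<Sum>i=1..n. g (\<xi> i \<omega>)) / n - ?m g = ((\<Sum>i=1..n. g (\<xi> i \<omega>)) - n * ?m g) / n"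
      using n by (simp add: field_simps)
    ultimately have 1: "\<bar>(\<Sum>i=1..n. g (\<xi> i \<omega>)) / n - ?m g\<bar> \<le> \<epsilon>"
      using n by (simp add: field_simps abs_divide)
    have int: "integrable Q h" if "h \<in> F" for h
      using meas[OF that] bdd[OF that] Q(2) spQ
      by (intro Q.integrable_const_bound[where B = B]) (auto cong: measurable_cong_sets)
    have "\<bar>?m f - ?m g\<bar> = \<bar>\<integral>x. f x - g x \<partial>Q\<bar>" using int[OF f] int[OF gF] by simp
    also have "\<dots> \<le> (\<integral>x. \<bar>f x - g x\<bar> \<partial>Q)" by (rule integral_abs_bound)
    also have "\<dots> \<le> (\<integral>x. \<eta> \<partial>Q)"
      using int[OF f] int[OF gF] g(2) spQ by (intro integral_mono) auto
    finally have 2: "\<bar>?m f - ?m g\<bar> \<le> \<eta>" by (simp add: Q.prob_space)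
    have "\<bar>(\<Sum>i=1..n. f (\<xi> i \<omega>)) - (\<Sum>i=1..n. g (\<xi> i \<omega>))\<bar> \<le> (\<Sum>i=1..n. \<bar>f (\<xi> i \<omega>) - g (\<xi> i \<omega>)\<bar>)"
      unfolding sum_subtractf[symmetric] by (rule sum_abs)
    also have "\<dots> \<le> (\<Sum>i=1..n. \<eta>)" using g(2) \<xi>S \<omega>M by (intro sum_mono) auto
    finally have "\<bar>(\<Sum>i=1..n. f (\<xi> i \<omega>)) - (\<Sum>i=1..n. g (\<xi> i \<omega>))\<bar> / n \<le> \<eta>"
      using n by (simp add: field_simps)
    then have 3: "\<bar>(\<Sum>i=1..n. f (\<xi> i \<omega>)) / n - (\<Sum>i=1..n. g (\<xi> i \<omega>)) / n\<bar> \<le> \<eta>"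
      using n by (simp add: diff_divide_distrib[symmetric])
    from 1 2 3 show ?thesis by linarith
  qed
  moreover have "E \<in> events" unfolding E_def using U_ev by auto
  ultimately show ?thesis by (intro bexI[of _ E]) (auto simp: E_def)
qed

section \<open>Nets and interior balls\<close>

lemma norm_divideR: "0 < t \<Longrightarrow> norm (x /\<^sub>R t) = norm x / t"
  by (simp add: field_simps)

text \<open>A maximal \<open>\<epsilon>\<close>-separated subset is an \<open>\<epsilon>\<close>-net, and the balls of radius \<open>\<epsilon> / 2\<close> around its points
  are disjoint subsets of a fixed ball, so comparing volumes bounds its cardinality. The exact
  power of \<open>1 / \<epsilon>\<close> is immaterial later, where only logarithms of cardinalities appear.\<close>

lemma small_net:
  fixes S :: "'a::euclidean_space set"
  assumes "bounded S"
  obtains A where "0 < A"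
    "\<And>\<epsilon>. 0 < \<epsilon> \<Longrightarrow> \<epsilon> \<le> 1 \<Longrightarrow> \<exists>T\<subseteq>S. finite T \<and> card T \<le> A / \<epsilon> ^ DIM('a) \<and> (\<forall>x\<in>S. \<exists>t\<in>T. norm (x - t) \<le> \<epsilon>)"
proof -
  obtain R where R: "0 < R" "\<And>x. x \<in> S \<Longrightarrow> norm x \<le> R"
    using assms by (auto simp: bounded_pos)
  define v where "v = measure lborel (ball (0::'a) 1)"
  have v: "0 < v" unfolding v_def by (rule content_ball_pos) simp
  define A where "A = (2 * (R + 1)) ^ DIM('a)"
  have "0 < A" using R by (simp add: A_def)
  moreover have "\<exists>T\<subseteq>S. finite T \<and> card T \<le> A / \<epsilon> ^ DIM('a) \<and> (\<forall>x\<in>S. \<exists>t\<in>T. norm (x - t) \<le> \<epsilon>)"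
    if \<epsilon>: "0 < \<epsilon>" "\<epsilon> \<le> 1" for \<epsilon>
  proof -
    define sep where "sep T \<longleftrightarrow> T \<subseteq> S \<and> finite T \<and> (\<forall>x\<in>T. \<forall>y\<in>T. x \<noteq> y \<longrightarrow> \<epsilon> < norm (x - y))" for T
    have card_sep: "card T \<le> A / \<epsilon> ^ DIM('a)" if T: "sep T" for T
    proof -
      have disj: "disjoint_family_on (\<lambda>x. ball x (\<epsilon> / 2)) T"
      proof (unfold disjoint_family_on_def, intro ballI impI)
        fix x y assume xy: "x \<in> T" "y \<in> T" "x \<noteq> y"
        have False if "z \<in> ball x (\<epsilon> / 2)" "z \<in> ball y (\<epsilon> / 2)" for z
        proof -
          have "dist x y \<le> dist x z + dist y z" by (rule dist_triangle2)
          also have "\<dots> < \<epsilon>" using that by simp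
          finally have "norm (x - y) < \<epsilon>" by (simp add: dist_norm)
          moreover have "\<epsilon> < norm (x - y)" using xy T unfolding sep_def by blast
          ultimately show False by simp
        qed
        then show "ball x (\<epsilon> / 2) \<inter> ball y (\<epsilon> / 2) = {}" by blast
      qed
      have fin: "finite T" using T by (simp add: sep_def)
      have "card T * ((\<epsilon> / 2) ^ DIM('a) * v) = (\<Sum>x\<in>T. measure lborel (ball x (\<epsilon> / 2)))"
        using \<epsilon> by (simp add: content_ball_conv_unit_ball[of "\<epsilon> / 2"] v_def)
      also have "\<dots> = measure lborel (\<Union>x\<in>T. ball x (\<epsilon> / 2))"
        using fin disj emeasure_lborel_ball_finite
        by (intro measure_finite_Union[symmetric]) (auto simp: less_top)
      also have "\<dots> \<le> measure lborel (ball (0::'a) (R + 1))"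
      proof (rule measure_mono_fmeasurable)
        show "(\<Union>x\<in>T. ball x (\<epsilon> / 2)) \<subseteq> ball 0 (R + 1)"
        proof
          fix z assume "z \<in> (\<Union>x\<in>T. ball x (\<epsilon> / 2))"
          then obtain x where x: "x \<in> T" "dist x z < \<epsilon> / 2" by auto
          have "norm z \<le> norm x + dist x z" by (metis dist_commute dist_norm norm_triangle_sub)
          moreover have "norm x \<le> R" using x T R by (auto simp: sep_def)
          ultimately show "z \<in> ball 0 (R + 1)" using x \<epsilon> by auto
        qed
        show "ball (0::'a) (R + 1) \<in> fmeasurable lborel"
          using emeasure_lborel_ball_finite[of "0::'a" "R + 1"] by (intro fmeasurableI) (auto simp: less_top)
      qed (use fin in auto)
      also have "\<dots> = (R + 1) ^ DIM('a) * v"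
        using R by (simp add: content_ball_conv_unit_ball[of "R + 1"] v_def)
      finally have "card T * (\<epsilon> / 2) ^ DIM('a) \<le> (R + 1) ^ DIM('a)" using v by simp
      then show ?thesis
        using \<epsilon> by (simp only: A_def power_divide power_mult_distrib) (simp add: field_simps)
    qed
    have "sep {}" by (simp add: sep_def)
    moreover have "\<forall>T. sep T \<longrightarrow> card T < nat \<lceil>A / \<epsilon> ^ DIM('a)\<rceil> + 1"
    proof (intro allI impI)
      fix T assume "sep T"
      then have "real (card T) \<le> A / \<epsilon> ^ DIM('a)" by (rule card_sep)
      then show "card T < nat \<lceil>A / \<epsilon> ^ DIM('a)\<rceil> + 1" by linarith
    qed
    ultimately have "\<exists>T. sep T \<and> (\<forall>T'. sep T' \<longrightarrow> card T' \<le> card T)"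
      by (rule ex_has_greatest_nat)
    then obtain T where T: "sep T" "\<And>T'. sep T' \<Longrightarrow> card T' \<le> card T" by auto
    have "\<exists>t\<in>T. norm (x - t) \<le> \<epsilon>" if x: "x \<in> S" for x
    proof (rule ccontr)
      assume c: "\<not> (\<exists>t\<in>T. norm (x - t) \<le> \<epsilon>)"
      then have "x \<notin> T" using \<epsilon> by auto
      moreover have "sep (insert x T)"
        using c x T(1) by (auto simp: sep_def not_le norm_minus_commute)
      ultimately show False using T(1) T(2)[of "insert x T"] by (auto simp: sep_def)
    qed
    then show ?thesis using T(1) card_sep[OF T(1)] by (auto simp: sep_def)
  qed
  ultimately show thesis by (rule that)
qed

text \<open>At every scale up to \<open>r\<close>, a fixed fraction of a ball around a point of \<open>S\<close> is filled by a ball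
  inside \<open>S\<close>. This is the common feature of the cone condition and of the triangle \<open>Omega_bar L\<close>
  that keeps the boundary normalization of a kernel away from \<open>0\<close>.\<close>

definition interior_balls :: "'a::euclidean_space set \<Rightarrow> real \<Rightarrow> real \<Rightarrow> bool" where
  "interior_balls S a r \<longleftrightarrow> 0 < a \<and> 0 < r \<and>
     (\<forall>x\<in>S. \<forall>s. 0 < s \<and> s \<le> r \<longrightarrow> (\<exists>c. ball c (a * s) \<subseteq> S \<inter> cball x s))"

text \<open>At scale \<open>s\<close> the ball is centred on the axis of the cone, at distance \<open>s / 2\<close> from its vertex.
  If the radius is a small enough multiple of \<open>s\<close>, then the directions from the vertex to the points
  of the ball deviate from the axis by less than \<open>\<eta>\<close>.\<close>

lemma interior_balls_cone:
  fixes S :: "'a::euclidean_space set"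
  assumes pos: "0 < \<rho>" "0 < \<eta>"
    and cone: "\<forall>z\<in>S. \<exists>\<xi>. norm \<xi> = 1 \<and>
      {z + t *\<^sub>R v | t v. 0 < t \<and> t < \<rho> \<and> norm v = 1 \<and> norm (v - \<xi>) < \<eta>} \<subseteq> S"
  shows "interior_balls S (min \<eta> 1 / 8) (\<rho> / 2)"
  unfolding interior_balls_def
proof (intro conjI ballI allI impI)
  fix x s assume x: "x \<in> S" and s: "0 < s \<and> s \<le> \<rho> / 2"
  obtain \<xi> where \<xi>: "norm \<xi> = 1"
    "{x + t *\<^sub>R v | t v. 0 < t \<and> t < \<rho> \<and> norm v = 1 \<and> norm (v - \<xi>) < \<eta>} \<subseteq> S"
    using cone x by blast
  define \<beta> where "\<beta> = min \<eta> 1"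
  have \<beta>: "0 < \<beta>" "\<beta> \<le> 1" "\<beta> \<le> \<eta>" using pos by (auto simp: \<beta>_def)
  have "y \<in> S \<inter> cball x s" if y: "y \<in> ball (x + (s / 2) *\<^sub>R \<xi>) (\<beta> / 8 * s)" for y
  proof -
    define e where "e = y - (x + (s / 2) *\<^sub>R \<xi>)"
    have e: "norm e < \<beta> * (s / 8)" using y by (simp add: e_def dist_norm norm_minus_commute)
    have "\<beta> * (s / 8) \<le> s / 8" using \<beta> s by (simp add: mult_left_le_one_le)
    then have e': "norm e < s / 8" using e by linarith
    define q where "q = (s / 2) *\<^sub>R \<xi> + e"
    define t where "t = norm q"
    have nq: "norm ((s / 2) *\<^sub>R \<xi>) = s / 2" using \<xi> s by simp
    have t1: "\<bar>t - s / 2\<bar> \<le> norm e"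
      using norm_triangle_ineq3[of q "(s / 2) *\<^sub>R \<xi>"] nq by (simp add: t_def q_def)
    have t: "s * 3 / 8 < t" "t < s" using t1 e' s by (auto simp: abs_if split: if_splits)
    have yq: "y = x + t *\<^sub>R (q /\<^sub>R t)" using t s by (simp add: e_def q_def)
    have "q /\<^sub>R t - \<xi> = ((s / 2 - t) *\<^sub>R \<xi> + e) /\<^sub>R t"
      using t s by (simp add: q_def algebra_simps)
    then have "norm (q /\<^sub>R t - \<xi>) = norm ((s / 2 - t) *\<^sub>R \<xi> + e) / t"
      using t s norm_divideR[of t "(s / 2 - t) *\<^sub>R \<xi> + e"] by (simp only:)
    also have "\<dots> \<le> (norm ((s / 2 - t) *\<^sub>R \<xi>) + norm e) / t"
      using t s by (intro divide_right_mono norm_triangle_ineq) auto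
    also have "\<dots> \<le> (2 * norm e) / t"
      using t t1 s \<xi> by (intro divide_right_mono) (auto simp: abs_minus_commute)
    also have "\<dots> < \<beta>"
    proof -
      have "0 < \<beta> * s" using \<beta> s by simp
      then have "2 * norm e < \<beta> * (s * 3 / 8)" using e by (simp add: algebra_simps)
      also have "\<dots> \<le> \<beta> * t" using t \<beta> by (intro mult_left_mono) auto
      finally show ?thesis using t s by (simp add: divide_less_eq)
    qed
    finally have "norm (q /\<^sub>R t - \<xi>) < \<eta>" using \<beta> by simp
    moreover have "0 < t" using t s by simp
    then have "norm (q /\<^sub>R t) = 1" using norm_divideR[of t q] t_def by (simp del: norm_scaleR)
    moreover have "0 < t" "t < \<rho>" using t s by auto
    ultimately have "x + t *\<^sub>R (q /\<^sub>R t) \<in> S" using \<xi>(2) by blast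
    then have "y \<in> S" using yq by simp
    moreover have "dist x y \<le> s"
    proof -
      have "y - x = q" by (simp add: e_def q_def)
      then have "dist x y = t" by (metis dist_commute dist_norm t_def)
      then show ?thesis using t by simp
    qed
    ultimately show ?thesis by simp
  qed
  then show "\<exists>c. ball c (min \<eta> 1 / 8 * s) \<subseteq> S \<inter> cball x s" unfolding \<beta>_def by blast
qed (use pos in auto)

text \<open>Contract one interior ball towards \<open>x\<close>, with ratio proportional to the scale.\<close>

lemma interior_balls_convex:
  fixes S :: "'a::euclidean_space set"
  assumes S: "convex S" and b: "0 < b" "ball c b \<subseteq> S" and R: "0 < R" "\<And>x y. x \<in> S \<Longrightarrow> y \<in> S \<Longrightarrow> dist x y \<le> R"
  shows "interior_balls S (b / R) R"
  unfolding interior_balls_def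
proof (intro conjI ballI allI impI)
  fix x s assume x: "x \<in> S" and s: "0 < s \<and> s \<le> R"
  define \<sigma> where "\<sigma> = s / R"
  have \<sigma>: "0 < \<sigma>" "\<sigma> \<le> 1" using s R by (auto simp: \<sigma>_def)
  have "y \<in> S \<inter> cball x s" if y: "y \<in> ball ((1 - \<sigma>) *\<^sub>R x + \<sigma> *\<^sub>R c) (b / R * s)" for y
  proof -
    define q where "q = c + (y - ((1 - \<sigma>) *\<^sub>R x + \<sigma> *\<^sub>R c)) /\<^sub>R \<sigma>"
    have yq: "y = (1 - \<sigma>) *\<^sub>R x + \<sigma> *\<^sub>R q" using \<sigma> by (simp add: q_def algebra_simps)
    have "dist c q = norm (y - ((1 - \<sigma>) *\<^sub>R x + \<sigma> *\<^sub>R c)) / \<sigma>"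
      using \<sigma> norm_divideR[of \<sigma>] by (simp add: q_def dist_norm del: norm_scaleR)
    also have "\<dots> < b"
    proof -
      have "b / R * s = b * \<sigma>" by (simp add: \<sigma>_def)
      then have "norm (y - ((1 - \<sigma>) *\<^sub>R x + \<sigma> *\<^sub>R c)) < b * \<sigma>"
        using y by (simp add: dist_norm norm_minus_commute)
      then show ?thesis using \<sigma> by (simp add: divide_less_eq)
    qed
    finally have q: "q \<in> S" using b by auto
    have "y \<in> S" unfolding yq using S x q \<sigma> by (intro convexD) auto
    moreover have "dist x y = norm (\<sigma> *\<^sub>R (x - q))"
      unfolding yq dist_norm by (simp add: algebra_simps)
    then have "dist x y \<le> \<sigma> * R" using R(2)[OF x q] \<sigma> by (simp add: dist_norm)
    then have "dist x y \<le> s" using R by (simp add: \<sigma>_def)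
    ultimately show ?thesis by simp
  qed
  then show "\<exists>c. ball c (b / R * s) \<subseteq> S \<inter> cball x s" by blast
qed (use b R in auto)

lemma compact_Omega_bar: "compact (Omega_bar L)"
proof -
  have "closed (Omega_bar L)"
  proof -
    have "Omega_bar L = {x. 0 \<le> fst x} \<inter> {x. fst x \<le> snd x} \<inter> {x. snd x \<le> L}"
      by (auto simp: Omega_bar_def)
    then show ?thesis
      by (auto intro!: closed_Int closed_Collect_le continuous_intros)
  qed
  moreover have "Omega_bar L \<subseteq> {0..L} \<times> {0..L}" by (auto simp: Omega_bar_def)
  then have "bounded (Omega_bar L)"
    by (rule bounded_subset[rotated]) (intro bounded_Times bounded_closed_interval)
  ultimately show ?thesis by (simp add: compact_eq_bounded_closed)
qed

lemma convex_Omega_bar: "convex (Omega_bar L)"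
proof -
  have "Omega_bar L = fst -` {0..} \<inter> (\<lambda>x. snd x - fst x) -` {0..} \<inter> snd -` {..L}"
    by (auto simp: Omega_bar_def)
  then show ?thesis
    by (auto intro!: convex_Int convex_linear_vimage linear_compose_sub linear_fst linear_snd)
qed

lemma interior_balls_Omega_bar:
  assumes L: "0 < L"
  obtains a r where "interior_balls (Omega_bar L) a r"
proof -
  have "ball (L / 4, 3 * L / 4) (L / 4) \<subseteq> Omega_bar L"
  proof
    fix x assume x: "x \<in> ball (L / 4, 3 * L / 4) (L / 4)"
    have "dist (L / 4) (fst x) < L / 4" "dist (3 * L / 4) (snd x) < L / 4"
      using x dist_fst_le[of "(L / 4, 3 * L / 4)" x] dist_snd_le[of "(L / 4, 3 * L / 4)" x] by auto
    then show "x \<in> Omega_bar L"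
      unfolding Omega_bar_def dist_real_def case_prod_unfold mem_Collect_eq by linarith
  qed
  moreover obtain R where R: "0 < R" "\<And>x y. x \<in> Omega_bar L \<Longrightarrow> y \<in> Omega_bar L \<Longrightarrow> dist x y \<le> R"
  proof -
    have "bounded (Omega_bar L)" using compact_Omega_bar by (rule compact_imp_bounded)
    then have "dist x y \<le> max 1 (diameter (Omega_bar L))" if "x \<in> Omega_bar L" "y \<in> Omega_bar L" for x y
      using diameter_bounded_bound that by (metis max.coboundedI2)
    then show thesis by (intro that[of "max 1 (diameter (Omega_bar L))"]) auto
  qed
  ultimately have "interior_balls (Omega_bar L) (L / 4 / R) R"
    using L by (intro interior_balls_convex[OF convex_Omega_bar _ _ R]) auto
  then show thesis by (rule that)
qed

section \<open>Kernels normalized at the boundary\<close>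

text \<open>Everything that the estimation argument uses about a boundary-normalized kernel. The upper bound
  \<open>A / h\<^sup>d\<close> determines the rate. The Lipschitz constant enters only through the mesh of a net, hence
  through a logarithm, so any fixed power of \<open>1 / h\<close> would serve; the power \<open>2 d + 1\<close> results from
  bounding the variation of the normalization crudely by the volume of \<open>S\<close>.\<close>

definition kernel_bounds :: "'a::euclidean_space set \<Rightarrow> ('a \<Rightarrow> real) \<Rightarrow> real \<Rightarrow> real \<Rightarrow> bool" where
  "kernel_bounds S K A h0 \<longleftrightarrow> 0 < A \<and> 0 < h0 \<and> h0 \<le> 1 \<and>
     (\<forall>h x. 0 < h \<longrightarrow> h \<le> h0 \<longrightarrow> x \<in> S \<longrightarrow>
        boundary_kernel S K h x \<in> borel_measurable borel \<and>
        (\<forall>y. 0 \<le> boundary_kernel S K h x y \<and> boundary_kernel S K h x y \<le> A / h ^ DIM('a)) \<and>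
        (\<forall>y. h < norm (y - x) \<longrightarrow> boundary_kernel S K h x y = 0) \<and>
        (LINT y:S|lborel. boundary_kernel S K h x y) = 1 \<and>
        (\<forall>x'\<in>S. \<forall>y. \<bar>boundary_kernel S K h x y - boundary_kernel S K h x' y\<bar>
           \<le> A / h ^ (2 * DIM('a) + 1) * norm (x - x')))"

lemma kernel_boundsD:
  fixes S :: "'a::euclidean_space set"
  assumes "kernel_bounds S K A h0" "0 < h" "h \<le> h0" "x \<in> S"
  shows "boundary_kernel S K h x \<in> borel_measurable borel"
    and "0 \<le> boundary_kernel S K h x y"
    and "boundary_kernel S K h x y \<le> A / h ^ DIM('a)"
    and "h < norm (y - x) \<Longrightarrow> boundary_kernel S K h x y = 0"
    and "(LINT y:S|lborel. boundary_kernel S K h x y) = 1"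
    and "x' \<in> S \<Longrightarrow> \<bar>boundary_kernel S K h x y - boundary_kernel S K h x' y\<bar>
           \<le> A / h ^ (2 * DIM('a) + 1) * norm (x - x')"
  using assms unfolding kernel_bounds_def by blast+

lemma kernel_bounds_mono:
  fixes S :: "'a::euclidean_space set"
  assumes b: "kernel_bounds S K A h0" and le: "A \<le> A'" "0 < h0'" "h0' \<le> h0"
  shows "kernel_bounds S K A' h0'"
proof -
  have "A / h ^ m \<le> A' / h ^ m" if "0 < h" for h :: real and m
    using le that by (intro divide_right_mono) auto
  moreover have "A / h ^ m * norm v \<le> A' / h ^ m * norm v" if "0 < h" for h :: real and m and v :: 'a
    using le that by (intro mult_right_mono divide_right_mono) auto
  ultimately show ?thesis
    using b le unfolding kernel_bounds_def
    by (smt (verit, ccfv_threshold))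
qed

text \<open>The kernel is at least \<open>k\<close> on a ball around \<open>0\<close>; rescaled to \<open>x\<close>, a fixed proportion of this ball
  lies in \<open>S\<close>. Hence the normalization is at least some \<open>\<gamma> > 0\<close>, uniformly in \<open>x\<close> and in small \<open>h\<close>.
  Given this, the bounds follow from those of the kernel and from the quotient rule.\<close>

lemma kernel_bounds_exist:
  fixes S :: "'a::euclidean_space set"
  assumes K: "smoothing_kernel K \<rho> k" and S: "compact S" and balls: "interior_balls S a r"
  shows "\<exists>A h0. kernel_bounds S K A h0"
proof -
  let ?d = "DIM('a)"
  have K0: "0 \<le> K x" for x using K by (simp add: smoothing_kernel_def)
  obtain m where m: "0 < m" "\<And>x. K x \<le> m"
    using K by (auto simp: smoothing_kernel_def bounded_pos abs_le_iff)
  obtain l where l: "l-lipschitz_on UNIV K" using K by (auto simp: smoothing_kernel_def)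
  have l0: "0 \<le> l" using l by (rule lipschitz_on_nonneg)
  have lip: "\<bar>K x - K y\<bar> \<le> l * norm (x - y)" for x y
    using lipschitz_onD[OF l, of x y] by (simp add: dist_norm)
  have contK: "continuous_on UNIV K" using l by (rule lipschitz_on_continuous_on)
  have supp: "K x = 0" if "1 < norm x" for x
  proof (rule ccontr)
    assume "K x \<noteq> 0"
    then have "x \<in> closure {x. K x \<noteq> 0}" by (intro subsetD[OF closure_subset]) simp
    then have "x \<in> cball 0 1" using K unfolding smoothing_kernel_def by blast
    then show False using that by simp
  qed
  have k: "0 < \<rho>" "0 < k" "\<And>x. norm x \<le> \<rho> \<Longrightarrow> k \<le> K x" using K by (auto simp: smoothing_kernel_def)
  have a: "0 < a" "0 < r" using balls by (auto simp: interior_balls_def)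
  define v where "v = measure lborel (ball (0::'a) 1)"
  have v: "0 < v" unfolding v_def by (rule content_ball_pos) simp
  define p where "p = min \<rho> 1"
  have p: "0 < p" "p \<le> 1" "p \<le> \<rho>" using k by (auto simp: p_def)
  define \<gamma> where "\<gamma> = k * (a * p) ^ ?d * v"
  have \<gamma>: "0 < \<gamma>" using k a p v by (simp add: \<gamma>_def)
  define J where "J h x y = K ((y - x) /\<^sub>R h) / h ^ ?d" for h x y
  have contJ: "continuous_on T (J h x)" for h x T
    unfolding J_def divide_inverse
    by (intro continuous_intros continuous_on_compose2[OF contK]) auto
  have intJ: "set_integrable lborel S (J h x)" for h x
    unfolding set_integrable_def using borel_integrable_compact[OF S contJ] .
  have c_def: "boundary_mass S K h x = (LINT y:S|lborel. J h x y)" for h x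
    by (simp add: boundary_mass_def J_def)
  have \<kappa>_def: "boundary_kernel S K h x y = J h x y / boundary_mass S K h x" for h x y
    by (simp add: boundary_kernel_def J_def)
  have fmS: "S \<in> fmeasurable lborel"
    using S by (intro fmeasurable_compact)
  have mass_ge: "\<gamma> \<le> boundary_mass S K h x" if h: "0 < h" "h \<le> r" and x: "x \<in> S" for h x
  proof -
    have "0 < p * h" "p * h \<le> r" using h p by (auto intro: order_trans[OF mult_left_le_one_le])
    then obtain c where c: "ball c (a * (p * h)) \<subseteq> S \<inter> cball x (p * h)"
      using balls x unfolding interior_balls_def by blast
    let ?B = "ball c (a * (p * h))"
    have "\<gamma> = (LINT y:?B|lborel. k / h ^ ?d)"
    proof -
      have "(LINT y:?B|lborel. k / h ^ ?d) = measure lborel ?B * (k / h ^ ?d)"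
        by (simp add: set_lebesgue_integral_def)
      then show ?thesis
        using h a p
        by (simp add: \<gamma>_def content_ball_conv_unit_ball[of "a * (p * h)"] v_def power_mult_distrib)
    qed
    also have "\<dots> \<le> (LINT y:S|lborel. J h x y)"
      unfolding set_lebesgue_integral_def
    proof (rule integral_mono)
      show "integrable lborel (\<lambda>y. indicat_real ?B y *\<^sub>R (k / h ^ ?d))"
        using emeasure_lborel_ball_finite[of c "a * (p * h)"] by simp
      show "integrable lborel (\<lambda>y. indicat_real S y *\<^sub>R J h x y)"
        using intJ by (simp add: set_integrable_def)
      show "indicat_real ?B y *\<^sub>R (k / h ^ ?d) \<le> indicat_real S y *\<^sub>R J h x y" for y
      proof (cases "y \<in> ?B")
        case True
        then have y: "y \<in> S" "norm (y - x) \<le> p * h" using c by (auto simp: dist_norm norm_minus_commute)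
        have "norm ((y - x) /\<^sub>R h) = norm (y - x) / h" using h(1) by (rule norm_divideR)
        also have "\<dots> \<le> p" using y h by (simp add: divide_le_eq)
        finally have "k \<le> K ((y - x) /\<^sub>R h)" using p by (intro k) simp
        then show ?thesis using True y h by (simp add: J_def divide_right_mono)
      next
        case False
        then show ?thesis using K0 h by (simp add: J_def indicator_def)
      qed
    qed
    finally show ?thesis by (simp add: c_def)
  qed
  have Jlip: "\<bar>J h x y - J h x' y\<bar> \<le> l / h ^ (?d + 1) * norm (x - x')" if h: "0 < h" for h x x' y
  proof -
    have "\<bar>J h x y - J h x' y\<bar> = \<bar>K ((y - x) /\<^sub>R h) - K ((y - x') /\<^sub>R h)\<bar> / h ^ ?d"
      using h by (simp add: J_def diff_divide_distrib[symmetric])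
    also have "\<dots> \<le> l * norm ((y - x) /\<^sub>R h - (y - x') /\<^sub>R h) / h ^ ?d"
      using h lip by (intro divide_right_mono) auto
    also have "norm ((y - x) /\<^sub>R h - (y - x') /\<^sub>R h) = norm (x - x') / h"
      using h norm_divideR[of h "x - x'"] norm_minus_commute[of x x'] 
      by (simp add: scaleR_diff_right[symmetric] norm_divideR del: norm_scaleR)
    finally show ?thesis by simp
  qed
  have mass_lip: "\<bar>boundary_mass S K h x - boundary_mass S K h x'\<bar> \<le> measure lborel S * l / h ^ (?d + 1) * norm (x - x')"
    if h: "0 < h" for h x x'
  proof -
    have "\<bar>boundary_mass S K h x - boundary_mass S K h x'\<bar> = \<bar>LINT y:S|lborel. J h x y - J h x' y\<bar>"
      unfolding c_def using intJ by (simp add: set_integral_diff)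
    also have "\<dots> \<le> (LINT y:S|lborel. \<bar>J h x y - J h x' y\<bar>)"
      using set_integral_norm_bound[OF set_integral_diff(1)[OF intJ[of h x] intJ[of h x']]] by simp
    also have "\<dots> \<le> (LINT y:S|lborel. l / h ^ (?d + 1) * norm (x - x'))"
      using Jlip[OF h] set_integrable_abs[OF set_integral_diff(1)[OF intJ[of h x] intJ[of h x']]] fmS
      by (intro set_integral_mono) (auto simp: set_integrable_def fmeasurable_def)
    also have "\<dots> = measure lborel S * l / h ^ (?d + 1) * norm (x - x')"
      using fmS by (subst set_integral_const) (auto simp: fmeasurable_def)
    finally show ?thesis .
  qed
  define A where "A = m / \<gamma> + l / \<gamma> + m * (measure lborel S * l) / \<gamma>\<^sup>2"
  define h0 where "h0 = min r 1"
  have Ap: "0 < A" "m / \<gamma> \<le> A"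
    unfolding A_def using m l0 \<gamma> by (auto intro!: add_pos_nonneg)
  have "kernel_bounds S K A h0"
    unfolding kernel_bounds_def
  proof (intro conjI allI impI ballI)
    show "0 < A" "0 < h0" "h0 \<le> 1" using Ap a by (auto simp: h0_def)
    show "boundary_kernel S K h x \<in> borel_measurable borel" for h x
    proof -
      have "J h x \<in> borel_measurable borel" by (intro borel_measurable_continuous_onI contJ)
      then show ?thesis unfolding \<kappa>_def by measurable
    qed
    show "(LINT y:S|lborel. boundary_kernel S K h x y) = 1" if "0 < h" "h \<le> h0" "x \<in> S" for h x
      using mass_ge[of h x] that \<gamma> by (simp add: \<kappa>_def c_def[symmetric] h0_def)
    show "h < norm (y - x) \<Longrightarrow> boundary_kernel S K h x y = 0" if "0 < h" for h x y
      using supp[of "(y - x) /\<^sub>R h"] that by (simp add: \<kappa>_def J_def norm_divideR del: norm_scaleR)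
    fix h :: real and x y assume h: "0 < h" "h \<le> h0" and x: "x \<in> S"
    have hr: "h \<le> r" "h \<le> 1" using h by (auto simp: h0_def)
    have c: "\<gamma> \<le> boundary_mass S K h x" using mass_ge h hr x by auto
    have J0: "0 \<le> J h x y" "J h x y \<le> m / h ^ ?d" for x
      using K0 m h by (auto simp: J_def divide_right_mono)
    show "0 \<le> boundary_kernel S K h x y" using J0 c \<gamma> by (simp add: \<kappa>_def)
    have "boundary_kernel S K h x y \<le> (m / h ^ ?d) / \<gamma>"
      unfolding \<kappa>_def using J0 c \<gamma> m h by (intro frac_le) auto
    also have "\<dots> = (m / \<gamma>) / h ^ ?d" by simp
    also have "\<dots> \<le> A / h ^ ?d" using Ap h by (intro divide_right_mono) auto
    finally show "boundary_kernel S K h x y \<le> A / h ^ ?d" .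
    fix x' assume x': "x' \<in> S"
    have c': "\<gamma> \<le> boundary_mass S K h x'" using mass_ge h hr x' by auto
    let ?c = "boundary_mass S K h x" and ?c' = "boundary_mass S K h x'"
    have pw: "1 / h ^ (?d + 1) \<le> 1 / h ^ (2 * ?d + 1)"
      using h hr by (intro divide_left_mono power_decreasing) auto
    have "boundary_kernel S K h x y - boundary_kernel S K h x' y
        = (J h x y - J h x' y) / ?c + J h x' y * (?c' - ?c) / (?c * ?c')"
      using c c' \<gamma> by (simp add: \<kappa>_def field_simps)
    then have "\<bar>boundary_kernel S K h x y - boundary_kernel S K h x' y\<bar>
        \<le> \<bar>J h x y - J h x' y\<bar> / ?c + J h x' y * \<bar>?c' - ?c\<bar> / (?c * ?c')"
      using abs_triangle_ineq[of "(J h x y - J h x' y) / ?c" "J h x' y * (?c' - ?c) / (?c * ?c')"] c c' \<gamma> J0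
      by (simp add: abs_mult)
    also have "\<dots> \<le> (l / h ^ (?d + 1) * norm (x - x')) / \<gamma>
        + (m / h ^ ?d) * (measure lborel S * l / h ^ (?d + 1) * norm (x - x')) / (\<gamma> * \<gamma>)"
      using Jlip[OF h(1), of x y x'] mass_lip[OF h(1), of x' x] c c' \<gamma> J0 m h l0
      by (intro add_mono frac_le mult_mono) (auto simp: norm_minus_commute)
    also have "\<dots> = (l / \<gamma> * (1 / h ^ (?d + 1)) + m * (measure lborel S * l) / \<gamma>\<^sup>2 * (1 / h ^ (2 * ?d + 1))) * norm (x - x')"
    proof -
      have pd: "h ^ (2 * ?d + 1) = h ^ ?d * h ^ (?d + 1)" by (simp add: mult_2 power_add)
      show ?thesis unfolding pd by (simp add: field_simps power2_eq_square)
    qed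
    also have "\<dots> \<le> (l / \<gamma> * (1 / h ^ (2 * ?d + 1)) + m * (measure lborel S * l) / \<gamma>\<^sup>2 * (1 / h ^ (2 * ?d + 1))) * norm (x - x')"
      using pw l0 \<gamma> by (intro mult_right_mono add_right_mono mult_left_mono) auto
    also have "\<dots> = ((l / \<gamma> + m * (measure lborel S * l) / \<gamma>\<^sup>2) / h ^ (2 * ?d + 1)) * norm (x - x')"
      by (simp add: add_divide_distrib)
    also have "\<dots> \<le> A / h ^ (2 * ?d + 1) * norm (x - x')"
      using m \<gamma> h by (intro mult_right_mono divide_right_mono) (auto simp: A_def)
    finally show "\<bar>boundary_kernel S K h x y - boundary_kernel S K h x' y\<bar> \<le> A / h ^ (2 * ?d + 1) * norm (x - x')" .
  qed
  then show ?thesis by blast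
qed

section \<open>Random normalized measures and their conditional means\<close>

lemma sets_diagram_measure [measurable_cong]:
  "sets (diagram_measure L a) = sets (restrict_space borel (Omega_bar L))"
  by (simp add: diagram_measure_def)

lemma space_diagram_measure: "space (diagram_measure L a) = Omega_bar L"
  by (simp add: diagram_measure_def space_restrict_space)

lemma sets_normalized_measure [measurable_cong]:
  "sets (normalized_measure L w a) = sets (restrict_space borel (Omega_bar L))"
  by (simp add: normalized_measure_def weighted_measure_def sets_diagram_measure)

lemma space_normalized_measure: "space (normalized_measure L w a) = Omega_bar L"
  by (simp add: normalized_measure_def weighted_measure_def space_diagram_measure space_scale_measure)

lemma measurable_emeasure_diagram:
  assumes A: "A \<in> sets (restrict_space borel (Omega_bar L))"
  shows "(\<lambda>a. emeasure (diagram_measure L a) A) \<in> borel_measurable (diagram_space L)"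
proof (rule measurableI)
  let ?G = "{{a \<in> persistence_diagrams L. emeasure (diagram_measure L a) A \<in> B} | A B.
        A \<in> sets (restrict_space borel (Omega_bar L)) \<and> B \<in> sets borel}"
  have G: "?G \<subseteq> Pow (persistence_diagrams L)" by auto
  have sp: "space (diagram_space L) = persistence_diagrams L"
    unfolding diagram_space_def by (rule space_measure_of[OF G])
  fix B :: "ennreal set" assume "B \<in> sets borel"
  then have "{a \<in> persistence_diagrams L. emeasure (diagram_measure L a) A \<in> B} \<in> ?G"
    using A by blast
  then have "{a \<in> persistence_diagrams L. emeasure (diagram_measure L a) A \<in> B} \<in> sets (diagram_space L)"
    unfolding diagram_space_def sets_measure_of[OF G] by (rule sigma_sets.Basic)
  moreover have "(\<lambda>a. emeasure (diagram_measure L a) A) -` B \<inter> space (diagram_space L) =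
      {a \<in> persistence_diagrams L. emeasure (diagram_measure L a) A \<in> B}"
    using sp by auto
  ultimately show "(\<lambda>a. emeasure (diagram_measure L a) A) -` B \<inter> space (diagram_space L) \<in> sets (diagram_space L)"
    by simp
qed simp

text \<open>The \<open>\<sigma>\<close>-algebra on diagrams makes the counts of Borel sets measurable; a monotone class argument
  passes to integrals.\<close>

lemma measurable_nn_integral_diagram:
  assumes "\<phi> \<in> borel_measurable (restrict_space borel (Omega_bar L))"
  shows "(\<lambda>a. \<integral>\<^sup>+x. \<phi> x \<partial>diagram_measure L a) \<in> borel_measurable (diagram_space L)"
  using assms
proof (induction rule: borel_measurable_induct)
  case (cong f g)
  have "(\<integral>\<^sup>+x. f x \<partial>diagram_measure L a) = (\<integral>\<^sup>+x. g x \<partial>diagram_measure L a)" for a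
    using cong(3) by (intro nn_integral_cong) (auto simp: space_diagram_measure space_restrict_space)
  then show ?case using cong by simp
next
  case (set A)
  then have "(\<integral>\<^sup>+x. indicator A x \<partial>diagram_measure L a) = emeasure (diagram_measure L a) A" for a
    by (intro nn_integral_indicator) (simp add: sets_diagram_measure)
  then show ?case using measurable_emeasure_diagram[OF set] by simp
next
  case (mult u c)
  have [measurable]: "u \<in> borel_measurable (diagram_measure L a)" for a
    using mult(2) by (simp cong: measurable_cong_sets add: sets_diagram_measure)
  show ?case using mult.IH by (simp add: nn_integral_cmult)
next
  case (add u v)
  have [measurable]: "u \<in> borel_measurable (diagram_measure L a)" "v \<in> borel_measurable (diagram_measure L a)" for a
    using add.hyps(1,3) by (simp_all cong: measurable_cong_sets add: sets_diagram_measure)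
  show ?case using add.IH by (simp add: nn_integral_add)
next
  case (seq U)
  have [measurable]: "U i \<in> borel_measurable (diagram_measure L a)" for a i
    using seq.hyps(1) by (simp cong: measurable_cong_sets add: sets_diagram_measure)
  have "(\<integral>\<^sup>+x. (SUP i. U i) x \<partial>diagram_measure L a) = (SUP i. \<integral>\<^sup>+x. U i x \<partial>diagram_measure L a)" for a
    using seq.hyps(3) by (simp add: nn_integral_monotone_convergence_SUP image_comp)
  then show ?case using seq.IH by simp
qed

lemma nn_integral_normalized_measure:
  assumes w: "w \<in> borel_measurable (restrict_space borel (Omega_bar L))"
    and \<phi>: "\<phi> \<in> borel_measurable (restrict_space borel (Omega_bar L))"
  shows "(\<integral>\<^sup>+x. \<phi> x \<partial>normalized_measure L w a) =
    1 / (\<integral>\<^sup>+x. ennreal (w x) \<partial>diagram_measure L a) * (\<integral>\<^sup>+x. ennreal (w x) * \<phi> x \<partial>diagram_measure L a)"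
proof -
  note [measurable] = w \<phi>
  have top: "Omega_bar L \<in> sets (diagram_measure L a)"
    using sets.top[of "diagram_measure L a"] unfolding space_diagram_measure .
  have "emeasure (weighted_measure L w a) (Omega_bar L) =
      (\<integral>\<^sup>+x. ennreal (w x) * indicator (Omega_bar L) x \<partial>diagram_measure L a)"
    unfolding weighted_measure_def by (rule emeasure_density[OF _ top]) measurable
  also have "\<dots> = (\<integral>\<^sup>+x. ennreal (w x) \<partial>diagram_measure L a)"
    by (intro nn_integral_cong) (simp add: space_diagram_measure)
  finally have W: "emeasure (weighted_measure L w a) (Omega_bar L) = (\<integral>\<^sup>+x. ennreal (w x) \<partial>diagram_measure L a)" .
  have "(\<integral>\<^sup>+x. \<phi> x \<partial>normalized_measure L w a) =
     1 / (\<integral>\<^sup>+x. ennreal (w x) \<partial>diagram_measure L a) * (\<integral>\<^sup>+x. \<phi> x \<partial>weighted_measure L w a)"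
    unfolding normalized_measure_def W
    by (intro nn_integral_scale_measure) (simp add: weighted_measure_def)
  also have "(\<integral>\<^sup>+x. \<phi> x \<partial>weighted_measure L w a) = (\<integral>\<^sup>+x. ennreal (w x) * \<phi> x \<partial>diagram_measure L a)"
    unfolding weighted_measure_def by (intro nn_integral_density) measurable
  finally show ?thesis .
qed

lemma measurable_nn_integral_normalized:
  assumes w: "w \<in> borel_measurable (restrict_space borel (Omega_bar L))"
    and \<phi>: "\<phi> \<in> borel_measurable (restrict_space borel (Omega_bar L))"
  shows "(\<lambda>a. \<integral>\<^sup>+x. \<phi> x \<partial>normalized_measure L w a) \<in> borel_measurable (diagram_space L)"
proof -
  note [measurable] = w \<phi>
  have [measurable]: "(\<lambda>a. \<integral>\<^sup>+x. ennreal (w x) \<partial>diagram_measure L a) \<in> borel_measurable (diagram_space L)"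
    "(\<lambda>a. \<integral>\<^sup>+x. ennreal (w x) * \<phi> x \<partial>diagram_measure L a) \<in> borel_measurable (diagram_space L)"
    by (intro measurable_nn_integral_diagram; measurable)+
  show ?thesis unfolding nn_integral_normalized_measure[OF w \<phi>] by measurable
qed

text \<open>An inequality only: a diagram of total weight \<open>0\<close> or \<open>\<infinity>\<close> is normalized to the zero measure.
  It makes all bounds on smoothed diagrams hold for every diagram, without exceptional sets.\<close>

lemma normalized_measure_le_1:
  assumes w: "w \<in> borel_measurable (restrict_space borel (Omega_bar L))"
  shows "emeasure (normalized_measure L w a) (Omega_bar L) \<le> 1"
proof -
  have "emeasure (normalized_measure L w a) (Omega_bar L) = (\<integral>\<^sup>+x. 1 \<partial>normalized_measure L w a)"
    by (simp add: space_normalized_measure)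
  also have "\<dots> = 1 / (\<integral>\<^sup>+x. ennreal (w x) \<partial>diagram_measure L a) * (\<integral>\<^sup>+x. ennreal (w x) \<partial>diagram_measure L a)"
    using nn_integral_normalized_measure[OF w, of "\<lambda>_. 1" a] by simp
  also have "\<dots> \<le> 1"
  proof -
    have "1 / x * x \<le> 1" for x :: ennreal
      by (cases "x = 0 \<or> x = \<top>") (auto simp: ennreal_divide_times less_top)
    then show ?thesis .
  qed
  finally show ?thesis .
qed

lemma finite_normalized_measure:
  assumes w: "w \<in> borel_measurable (restrict_space borel (Omega_bar L))"
  shows "finite_measure (normalized_measure L w a)"
    and "measure (normalized_measure L w a) (space (normalized_measure L w a)) \<le> 1"
proof -
  let ?N = "normalized_measure L w a"
  have le: "emeasure ?N (space ?N) \<le> 1"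
    using normalized_measure_le_1[OF w] by (simp add: space_normalized_measure)
  then show fin: "finite_measure ?N" by (intro finite_measureI) (auto simp: top_unique)
  interpret N: finite_measure ?N by (rule fin)
  show "measure ?N (space ?N) \<le> 1"
    using le by (simp add: N.emeasure_eq_measure ennreal_le_1)
qed

text \<open>The conditional mean is defined through the masses of fixed sets. For an indicator \<open>\<phi>\<close> the
  claim is the characteristic property of conditional expectation, tested against \<open>g (Z)\<close>; a monotone
  class argument extends it to integrands \<open>\<phi>\<close>. Joint measurability of the density \<open>l\<close> is what makes
  the inner integrals on the right measurable functions of \<open>Z\<close>.\<close>

lemma conditional_mean_nn_integral:
  fixes X :: "'p \<Rightarrow> 'u measure" and l :: "'z::topological_space \<Rightarrow> 'u \<Rightarrow> ennreal" and g :: "'z \<Rightarrow> real"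
  assumes P: "prob_space P" and Z [measurable]: "Z \<in> borel_measurable P"
    and \<Lambda>: "conditional_mean_measure P N Z X \<Lambda>"
    and X: "\<And>\<omega>. sets (X \<omega>) = sets N" "\<And>\<omega>. emeasure (X \<omega>) (space N) \<le> 1"
    and X_meas: "\<And>\<phi>. \<phi> \<in> borel_measurable N \<Longrightarrow> (\<lambda>\<omega>. \<integral>\<^sup>+x. \<phi> x \<partial>X \<omega>) \<in> borel_measurable P"
    and R: "sigma_finite_measure R" and R_sets [measurable_cong]: "sets R = sets N"
    and l [measurable]: "(\<lambda>(z, u). l z u) \<in> borel_measurable (borel \<Otimes>\<^sub>M R)"
    and density: "AE \<omega> in P. \<Lambda> (Z \<omega>) = density R (l (Z \<omega>)) \<and> emeasure (\<Lambda> (Z \<omega>)) (space N) < \<infinity>"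
    and g [measurable]: "g \<in> borel_measurable borel" and g0: "\<And>z. 0 \<le> g z" and gB: "\<And>z. g z \<le> G"
    and \<phi>: "\<phi> \<in> borel_measurable N"
  shows "(\<integral>\<^sup>+\<omega>. ennreal (g (Z \<omega>)) * (\<integral>\<^sup>+x. \<phi> x \<partial>X \<omega>) \<partial>P) =
    (\<integral>\<^sup>+\<omega>. ennreal (g (Z \<omega>)) * (\<integral>\<^sup>+x. \<phi> x * l (Z \<omega>) x \<partial>R) \<partial>P)"
  using \<phi>
proof (induction rule: borel_measurable_induct)
  case (cong f h)
  have "(\<integral>\<^sup>+x. f x \<partial>X \<omega>) = (\<integral>\<^sup>+x. h x \<partial>X \<omega>)" for \<omega>
    using cong(3) sets_eq_imp_space_eq[OF X(1)] by (intro nn_integral_cong) auto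
  moreover have "(\<integral>\<^sup>+x. f x * l z x \<partial>R) = (\<integral>\<^sup>+x. h x * l z x \<partial>R)" for z
    using cong(3) sets_eq_imp_space_eq[OF R_sets] by (intro nn_integral_cong) auto
  ultimately show ?case using cong.IH by simp
next
  case (set A)
  interpret P: prob_space P by (rule P)
  interpret R: sigma_finite_measure R by (rule R)
  let ?F = "vimage_algebra (space P) Z borel"
  interpret F: finite_measure_subalgebra P ?F
  proof
    show "subalgebra P ?F"
      using Z by (auto simp: subalgebra_def sets_vimage_algebra2)
  qed
  have gF: "(\<lambda>\<omega>. g (Z \<omega>)) \<in> borel_measurable ?F"
    by (rule measurable_compose[OF measurable_vimage_algebra1 g]) simp
  have XA: "emeasure (X \<omega>) A \<le> 1" for \<omega>
  proof -
    have "emeasure (X \<omega>) A \<le> emeasure (X \<omega>) (space N)"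
      using set sets.sets_into_space[OF set] X(1) by (intro emeasure_mono) auto
    then show ?thesis using X(2)[of \<omega>] by (rule order_trans)
  qed
  have XAm: "emeasure (X \<omega>) A = ennreal (measure (X \<omega>) A)" for \<omega>
    using XA[of \<omega>] by (intro emeasure_eq_ennreal_measure) (auto simp: top_unique)
  have XA1: "measure (X \<omega>) A \<le> 1" for \<omega>
    using XA[of \<omega>] unfolding XAm by (simp add: ennreal_le_1)
  have eX: "(\<integral>\<^sup>+x. indicator A x \<partial>X \<omega>) = emeasure (X \<omega>) A" for \<omega>
    using set X(1) by simp
  have "(\<lambda>\<omega>. emeasure (X \<omega>) A) \<in> borel_measurable P"
    using X_meas[of "indicator A"] set unfolding eX by simp
  then have meas [measurable]: "(\<lambda>\<omega>. measure (X \<omega>) A) \<in> borel_measurable P"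
    unfolding measure_def by measurable
  have int: "integrable P (\<lambda>\<omega>. g (Z \<omega>) * measure (X \<omega>) A)"
  proof (rule P.integrable_const_bound[where B = G])
    show "AE \<omega> in P. norm (g (Z \<omega>) * measure (X \<omega>) A) \<le> G"
    proof (rule AE_I2)
      fix \<omega>
      have "g (Z \<omega>) * measure (X \<omega>) A \<le> G * 1"
        using g0 gB XA1 order_trans[OF g0 gB] by (intro mult_mono) auto
      then show "norm (g (Z \<omega>) * measure (X \<omega>) A) \<le> G" using g0 by simp
    qed
  qed measurable
  note ce = F.real_cond_exp_intg[OF int gF meas]
  have \<Lambda>A: "AE \<omega> in P. real_cond_exp P ?F (\<lambda>\<omega>'. measure (X \<omega>') A) \<omega> = measure (\<Lambda> (Z \<omega>)) A"
    using \<Lambda> set unfolding conditional_mean_measure_def by blast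
  have "(\<integral>\<^sup>+\<omega>. ennreal (g (Z \<omega>)) * (\<integral>\<^sup>+x. indicator A x \<partial>X \<omega>) \<partial>P)
      = (\<integral>\<^sup>+\<omega>. ennreal (g (Z \<omega>) * measure (X \<omega>) A) \<partial>P)"
    unfolding eX XAm using g0 by (simp add: ennreal_mult')
  also have "\<dots> = ennreal (\<integral>\<omega>. g (Z \<omega>) * measure (X \<omega>) A \<partial>P)"
    using g0 int by (intro nn_integral_eq_integral) auto
  also have "\<dots> = ennreal (\<integral>\<omega>. g (Z \<omega>) * real_cond_exp P ?F (\<lambda>\<omega>'. measure (X \<omega>') A) \<omega> \<partial>P)"
    using ce(2) by simp
  also have "\<dots> = (\<integral>\<^sup>+\<omega>. ennreal (g (Z \<omega>) * real_cond_exp P ?F (\<lambda>\<omega>'. measure (X \<omega>') A) \<omega>) \<partial>P)"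
    using ce(1) \<Lambda>A g0 by (intro nn_integral_eq_integral[symmetric]) auto
  also have "\<dots> = (\<integral>\<^sup>+\<omega>. ennreal (g (Z \<omega>)) * (\<integral>\<^sup>+x. indicator A x * l (Z \<omega>) x \<partial>R) \<partial>P)"
  proof (rule nn_integral_cong_AE)
    show "AE \<omega> in P. ennreal (g (Z \<omega>) * real_cond_exp P ?F (\<lambda>\<omega>'. measure (X \<omega>') A) \<omega>) =
        ennreal (g (Z \<omega>)) * (\<integral>\<^sup>+x. indicator A x * l (Z \<omega>) x \<partial>R)"
      using \<Lambda>A density
    proof eventually_elim
      case (elim \<omega>)
      have lz: "l (Z \<omega>) \<in> borel_measurable R"
        using measurable_compose[OF measurable_Pair1' l, of "Z \<omega>"] by simp
      have sA: "A \<in> sets R" using set R_sets by simp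
      have sets\<Lambda>: "sets (\<Lambda> (Z \<omega>)) = sets N" using elim R_sets by simp
      have "emeasure (\<Lambda> (Z \<omega>)) A \<le> emeasure (\<Lambda> (Z \<omega>)) (space N)"
        using set sets.sets_into_space[OF set] sets\<Lambda> by (intro emeasure_mono) auto
      also have "\<dots> < \<infinity>" by (rule conjunct2[OF elim(2)])
      finally have "ennreal (measure (\<Lambda> (Z \<omega>)) A) = emeasure (\<Lambda> (Z \<omega>)) A"
        by (intro emeasure_eq_ennreal_measure[symmetric]) auto
      also have "\<dots> = (\<integral>\<^sup>+x. indicator A x * l (Z \<omega>) x \<partial>R)"
        using elim emeasure_density[OF lz sA] by (simp add: mult.commute)
      finally show ?case using elim g0 by (simp add: ennreal_mult')
    qed
  qed
  finally show ?case .
next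
  case (mult u c)
  interpret R: sigma_finite_measure R by (rule R)
  have [measurable]: "u \<in> borel_measurable R" using mult(2) by simp
  have [measurable]: "u \<in> borel_measurable (X \<omega>)" for \<omega>
    using mult(2) X(1) by (simp cong: measurable_cong_sets)
  note [measurable] = X_meas[OF mult(2)]
  have lz [measurable]: "l z \<in> borel_measurable R" for z
    using measurable_compose[OF measurable_Pair1' l, of z] by simp
  have 1: "(\<integral>\<^sup>+x. c * u x \<partial>X \<omega>) = c * (\<integral>\<^sup>+x. u x \<partial>X \<omega>)" for \<omega>
    by (rule nn_integral_cmult) measurable
  have 2: "(\<integral>\<^sup>+x. c * u x * l z x \<partial>R) = c * (\<integral>\<^sup>+x. u x * l z x \<partial>R)" for z
    unfolding mult.assoc by (rule nn_integral_cmult) measurable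
  have "(\<integral>\<^sup>+\<omega>. ennreal (g (Z \<omega>)) * (\<integral>\<^sup>+x. c * u x \<partial>X \<omega>) \<partial>P)
      = c * (\<integral>\<^sup>+\<omega>. ennreal (g (Z \<omega>)) * (\<integral>\<^sup>+x. u x \<partial>X \<omega>) \<partial>P)"
    unfolding 1 mult.left_commute[of _ c] by (rule nn_integral_cmult) measurable
  moreover have "(\<integral>\<^sup>+\<omega>. ennreal (g (Z \<omega>)) * (\<integral>\<^sup>+x. (c * u x) * l (Z \<omega>) x \<partial>R) \<partial>P)
      = c * (\<integral>\<^sup>+\<omega>. ennreal (g (Z \<omega>)) * (\<integral>\<^sup>+x. u x * l (Z \<omega>) x \<partial>R) \<partial>P)"
    unfolding 2 mult.left_commute[of _ c] by (rule nn_integral_cmult) measurable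
  ultimately show ?case using mult.IH by simp
next
  case (add u v)
  interpret R: sigma_finite_measure R by (rule R)
  have [measurable]: "u \<in> borel_measurable R" "v \<in> borel_measurable R" using add.hyps(1,3) by simp_all
  have [measurable]: "u \<in> borel_measurable (X \<omega>)" "v \<in> borel_measurable (X \<omega>)" for \<omega>
    using add.hyps(1,3) X(1) by (simp_all cong: measurable_cong_sets)
  note [measurable] = X_meas[OF add.hyps(1)] X_meas[OF add.hyps(3)]
  have lz [measurable]: "l z \<in> borel_measurable R" for z
    using measurable_compose[OF measurable_Pair1' l, of z] by simp
  show ?case using add.IH
    by (simp add: nn_integral_add distrib_left distrib_right)
next
  case (seq U)
  interpret R: sigma_finite_measure R by (rule R)
  have [measurable]: "U i \<in> borel_measurable R" for i using seq.hyps(1) by simp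
  have [measurable]: "U i \<in> borel_measurable (X \<omega>)" for \<omega> i
    using seq.hyps(1) X(1) by (simp cong: measurable_cong_sets)
  note [measurable] = X_meas[OF seq.hyps(1)]
  have lz [measurable]: "l z \<in> borel_measurable R" for z
    using measurable_compose[OF measurable_Pair1' l, of z] by simp
  have mono: "U i x \<le> U j x" if "i \<le> j" for i j x using seq.hyps(3) that by (auto simp: incseq_def le_fun_def)
  have "(\<integral>\<^sup>+\<omega>. ennreal (g (Z \<omega>)) * (\<integral>\<^sup>+x. (SUP i. U i) x \<partial>X \<omega>) \<partial>P)
     = (\<integral>\<^sup>+\<omega>. (SUP i. ennreal (g (Z \<omega>)) * (\<integral>\<^sup>+x. U i x \<partial>X \<omega>)) \<partial>P)"
    using seq.hyps(3) by (simp add: nn_integral_monotone_convergence_SUP image_comp SUP_mult_left_ennreal)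
  also have "\<dots> = (SUP i. \<integral>\<^sup>+\<omega>. ennreal (g (Z \<omega>)) * (\<integral>\<^sup>+x. U i x \<partial>X \<omega>) \<partial>P)"
    by (intro nn_integral_monotone_convergence_SUP)
      (auto simp: incseq_def le_fun_def intro!: mult_left_mono nn_integral_mono mono)
  also have "\<dots> = (SUP i. \<integral>\<^sup>+\<omega>. ennreal (g (Z \<omega>)) * (\<integral>\<^sup>+x. U i x * l (Z \<omega>) x \<partial>R) \<partial>P)"
    using seq.IH by simp
  also have "\<dots> = (\<integral>\<^sup>+\<omega>. (SUP i. ennreal (g (Z \<omega>)) * (\<integral>\<^sup>+x. U i x * l (Z \<omega>) x \<partial>R)) \<partial>P)"
    by (intro nn_integral_monotone_convergence_SUP[symmetric])
      (auto simp: incseq_def le_fun_def intro!: mult_left_mono mult_right_mono nn_integral_mono mono)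
  also have "\<dots> = (\<integral>\<^sup>+\<omega>. ennreal (g (Z \<omega>)) * (\<integral>\<^sup>+x. (SUP i. U i x * l (Z \<omega>) x) \<partial>R) \<partial>P)"
  proof -
    have "(\<integral>\<^sup>+x. (SUP i. U i x * l z x) \<partial>R) = (SUP i. \<integral>\<^sup>+x. U i x * l z x \<partial>R)" for z
      by (intro nn_integral_monotone_convergence_SUP)
        (auto simp: incseq_def le_fun_def intro!: mult_right_mono mono)
    then show ?thesis by (simp add: SUP_mult_left_ennreal)
  qed
  also have "\<dots> = (\<integral>\<^sup>+\<omega>. ennreal (g (Z \<omega>)) * (\<integral>\<^sup>+x. (SUP i. U i) x * l (Z \<omega>) x \<partial>R) \<partial>P)"
    by (simp add: SUP_mult_right_ennreal image_comp)
  finally show ?case .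
qed

section \<open>Expectations of kernel averages\<close>

text \<open>The geometry of the two domains enters only through \<open>kernel_bounds\<close>, with a common constant \<open>A\<close>
  and a common maximal bandwidth \<open>h0\<close>.\<close>

locale intensity_model = prob_space P for P :: "'p measure" +
  fixes L :: real and Z :: "'p \<Rightarrow> real^'d" and D :: "'p \<Rightarrow> diagram" and w :: "real \<times> real \<Rightarrow> real"
    and \<Z> :: "(real^'d) set" and KZ :: "real^'d \<Rightarrow> real" and KU :: "real \<times> real \<Rightarrow> real"
    and pZ :: "real^'d \<Rightarrow> real" and \<Lambda> :: "real^'d \<Rightarrow> (real \<times> real) measure"
    and lam :: "real^'d \<Rightarrow> real \<times> real \<Rightarrow> real" and A h0 cZ CZ lmax :: real
  assumes D [measurable]: "D \<in> measurable P (diagram_space L)"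
    and w [measurable]: "w \<in> borel_measurable (restrict_space borel (Omega_bar L))"
    and compact_\<Z>: "compact \<Z>"
    and KZ: "kernel_bounds \<Z> KZ A h0"
    and KU: "kernel_bounds (Omega_bar L) KU A h0"
    and Z: "distributed P lborel Z (\<lambda>z. ennreal (pZ z) * indicator \<Z> z)"
    and cZ: "0 < cZ"
    and pZ: "\<forall>z\<in>\<Z>. cZ \<le> pZ z \<and> pZ z \<le> CZ"
    and \<Lambda>: "conditional_mean_measure P (restrict_space borel (Omega_bar L)) Z
               (\<lambda>\<omega>. normalized_measure L w (D \<omega>)) \<Lambda>"
    and lam_nonneg: "\<And>z u. z \<in> \<Z> \<Longrightarrow> u \<in> Omega_bar L \<Longrightarrow> 0 \<le> lam z u"
    and lam_density: "\<forall>z\<in>\<Z>. \<Lambda> z =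
               density (restrict_space lborel (Omega_bar L)) (\<lambda>u. ennreal (lam z u))"
    and lam_le: "\<And>z u. z \<in> \<Z> \<Longrightarrow> u \<in> Omega_bar L \<Longrightarrow> lam z u \<le> lmax"
    and lam_continuous: "continuous_on (\<Z> \<times> Omega_bar L) (\<lambda>(z, u). lam z u)"
begin

abbreviation "\<kappa>Z h \<equiv> boundary_kernel \<Z> KZ h"
abbreviation "\<kappa>U h \<equiv> boundary_kernel (Omega_bar L) KU h"

lemma kernel_consts: "0 < A" "0 < h0" "h0 \<le> 1"
  using KZ by (auto simp: kernel_bounds_def)

lemma Z_meas [measurable]: "Z \<in> borel_measurable P"
  using distributed_measurable[OF Z] by simp

lemma sets_\<Z> [measurable]: "\<Z> \<in> sets borel"
  using compact_\<Z> by (simp add: borel_closed compact_imp_closed)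

lemma sets_Omega_bar [measurable]: "Omega_bar L \<in> sets borel"
  using compact_Omega_bar by (simp add: borel_closed compact_imp_closed)

lemma AE_in_\<Z>: "AE \<omega> in P. Z \<omega> \<in> \<Z>"
  by (subst distributed_AE2[OF Z]) (auto split: split_indicator_asm)

lemma \<Z>_nonempty: "\<Z> \<noteq> {}"
  using AE_in_\<Z> AE_False by auto

text \<open>A smoothed diagram integrates the kernel against a measure of mass at most \<open>1\<close>, so it inherits
  the bounds of the kernel.\<close>

lemma nn_integral_smoothed:
  assumes h: "0 < h" "h \<le> h0" and u: "u \<in> Omega_bar L"
  shows "(\<integral>\<^sup>+v. ennreal (\<kappa>U h u v) \<partial>normalized_measure L w a) = ennreal (smoothed_diagram L w KU h a u)"
    and "0 \<le> smoothed_diagram L w KU h a u" and "smoothed_diagram L w KU h a u \<le> A / h\<^sup>2"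
    and "integrable (normalized_measure L w a) (\<kappa>U h u)"
proof -
  note k = kernel_boundsD[OF KU h u]
  let ?N = "normalized_measure L w a"
  have m: "\<kappa>U h u \<in> borel_measurable ?N"
    using measurable_restrict_space1[OF k(1), of "Omega_bar L"]
    by (simp cong: measurable_cong_sets add: sets_normalized_measure)
  interpret N: finite_measure ?N by (rule finite_normalized_measure(1)[OF w])
  note mass = finite_normalized_measure(2)[OF w, of a]
  show int: "integrable ?N (\<kappa>U h u)"
    using k(2,3) m by (intro N.integrable_const_bound[where B = "A / h ^ DIM(real \<times> real)"]) auto
  show "(\<integral>\<^sup>+v. ennreal (\<kappa>U h u v) \<partial>?N) = ennreal (smoothed_diagram L w KU h a u)"
    unfolding smoothed_diagram_def using int k(2) by (intro nn_integral_eq_integral) auto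
  show "0 \<le> smoothed_diagram L w KU h a u"
    unfolding smoothed_diagram_def using k(2) by (intro integral_nonneg_AE) auto
  have "smoothed_diagram L w KU h a u \<le> (\<integral>v. A / h\<^sup>2 \<partial>?N)"
    unfolding smoothed_diagram_def
  proof (rule integral_mono)
    show "\<kappa>U h u v \<le> A / h\<^sup>2" for v using k(3)[of v] by (simp add: power2_eq_square)
  qed (use int in auto)
  also have "\<dots> \<le> A / h\<^sup>2 * 1"
    using mass kernel_consts h mult_left_mono[OF mass, of "A / h\<^sup>2"] by (simp add: mult.commute)
  finally show "smoothed_diagram L w KU h a u \<le> A / h\<^sup>2" by simp
qed

lemma smoothed_lipschitz:
  assumes h: "0 < h" "h \<le> h0" and u: "u \<in> Omega_bar L" "u' \<in> Omega_bar L"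
  shows "\<bar>smoothed_diagram L w KU h a u - smoothed_diagram L w KU h a u'\<bar> \<le> A / h ^ 5 * norm (u - u')"
proof -
  let ?N = "normalized_measure L w a"
  interpret N: finite_measure ?N by (rule finite_normalized_measure(1)[OF w])
  note mass = finite_normalized_measure(2)[OF w, of a]
  note int = nn_integral_smoothed(4)[OF h u(1), of a] nn_integral_smoothed(4)[OF h u(2), of a]
  have "\<bar>smoothed_diagram L w KU h a u - smoothed_diagram L w KU h a u'\<bar> =
      \<bar>\<integral>v. \<kappa>U h u v - \<kappa>U h u' v \<partial>?N\<bar>"
    unfolding smoothed_diagram_def using int by simp
  also have "\<dots> \<le> (\<integral>v. \<bar>\<kappa>U h u v - \<kappa>U h u' v\<bar> \<partial>?N)" by (rule integral_abs_bound)
  also have "\<dots> \<le> (\<integral>v. A / h ^ 5 * norm (u - u') \<partial>?N)"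
    using int kernel_boundsD(6)[OF KU h u] by (intro integral_mono) auto
  also have "\<dots> \<le> A / h ^ 5 * norm (u - u') * 1"
    using kernel_consts h mult_left_mono[OF mass, of "A / h ^ 5 * norm (u - u')"] by (simp add: mult_ac)
  finally show ?thesis by simp
qed

lemma measurable_smoothed:
  assumes h: "0 < h" "h \<le> h0" and u: "u \<in> Omega_bar L"
  shows "(\<lambda>a. smoothed_diagram L w KU h a u) \<in> borel_measurable (diagram_space L)"
proof -
  have "(\<lambda>v. ennreal (\<kappa>U h u v)) \<in> borel_measurable (restrict_space borel (Omega_bar L))"
    using kernel_boundsD(1)[OF KU h u] by (intro measurable_restrict_space1) simp
  from measurable_nn_integral_normalized[OF w this]
  have "(\<lambda>a. ennreal (smoothed_diagram L w KU h a u)) \<in> borel_measurable (diagram_space L)"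
    unfolding nn_integral_smoothed(1)[OF h u] .
  then have "(\<lambda>a. enn2real (ennreal (smoothed_diagram L w KU h a u))) \<in> borel_measurable (diagram_space L)"
    by measurable
  then show ?thesis by (simp add: nn_integral_smoothed(2)[OF h u])
qed

text \<open>The boundary normalization makes the kernel integrate to \<open>1\<close> over \<open>\<Z>\<close>, so its mean against the
  density \<open>pZ\<close> is an average of values in \<open>[cZ, CZ]\<close>.\<close>

lemma expectation_kernel:
  assumes h: "0 < h" "h \<le> h0" and z: "z \<in> \<Z>"
  shows "cZ \<le> expectation (\<lambda>\<omega>. \<kappa>Z h z (Z \<omega>))" "expectation (\<lambda>\<omega>. \<kappa>Z h z (Z \<omega>)) \<le> CZ"
    and "integrable P (\<lambda>\<omega>. \<kappa>Z h z (Z \<omega>))"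
proof -
  note k = kernel_boundsD[OF KZ h z]
  note [measurable] = k(1)
  show int: "integrable P (\<lambda>\<omega>. \<kappa>Z h z (Z \<omega>))"
    using k(2,3) by (intro integrable_const_bound[where B = "A / h ^ DIM(real^'d)"]) auto
  have CZ: "0 < CZ" using \<Z>_nonempty cZ pZ by fastforce
  have eq: "ennreal (expectation (\<lambda>\<omega>. \<kappa>Z h z (Z \<omega>)))
      = (\<integral>\<^sup>+y. (ennreal (pZ y) * indicator \<Z> y) * ennreal (\<kappa>Z h z y) \<partial>lborel)"
    using int k(2) by (subst distributed_nn_integral[OF Z]) (auto intro!: nn_integral_eq_integral[symmetric])
  have "set_integrable lborel \<Z> (\<kappa>Z h z)"
    using k(5) not_integrable_integral_eq[of lborel "\<lambda>y. indicator \<Z> y *\<^sub>R \<kappa>Z h z y"]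
    unfolding set_integrable_def set_lebesgue_integral_def by fastforce
  then have "(\<integral>\<^sup>+y. ennreal (indicator \<Z> y * \<kappa>Z h z y) \<partial>lborel) = ennreal (LINT y:\<Z>|lborel. \<kappa>Z h z y)"
    unfolding set_integrable_def set_lebesgue_integral_def using k(2)
    by (subst nn_integral_eq_integral) auto
  then have one: "(\<integral>\<^sup>+y. indicator \<Z> y * ennreal (\<kappa>Z h z y) \<partial>lborel) = 1"
    using k(2,5) by (simp add: ennreal_mult' ennreal_indicator)
  have "ennreal cZ = (\<integral>\<^sup>+y. ennreal cZ * (indicator \<Z> y * ennreal (\<kappa>Z h z y)) \<partial>lborel)"
    using one by (simp add: nn_integral_cmult)
  also have "\<dots> \<le> (\<integral>\<^sup>+y. (ennreal (pZ y) * indicator \<Z> y) * ennreal (\<kappa>Z h z y) \<partial>lborel)"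
    using pZ by (intro nn_integral_mono) (auto simp: ennreal_leI mult_right_mono split: split_indicator)
  finally show "cZ \<le> expectation (\<lambda>\<omega>. \<kappa>Z h z (Z \<omega>))"
    unfolding eq[symmetric] using k(2) by (subst (asm) ennreal_le_iff) auto
  have "(\<integral>\<^sup>+y. (ennreal (pZ y) * indicator \<Z> y) * ennreal (\<kappa>Z h z y) \<partial>lborel)
      \<le> (\<integral>\<^sup>+y. ennreal CZ * (indicator \<Z> y * ennreal (\<kappa>Z h z y)) \<partial>lborel)"
    using pZ by (intro nn_integral_mono) (auto simp: ennreal_leI mult_right_mono split: split_indicator)
  also have "\<dots> = ennreal CZ" using one by (simp add: nn_integral_cmult)
  finally show "expectation (\<lambda>\<omega>. \<kappa>Z h z (Z \<omega>)) \<le> CZ"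
    unfolding eq[symmetric] using CZ by (subst (asm) ennreal_le_iff) auto
qed

lemma integrable_product:
  assumes hZ: "0 < hZ" "hZ \<le> h0" and hU: "0 < hU" "hU \<le> h0" and z: "z \<in> \<Z>" and u: "u \<in> Omega_bar L"
  shows "integrable P (\<lambda>\<omega>. \<kappa>Z hZ z (Z \<omega>) * smoothed_diagram L w KU hU (D \<omega>) u)"
proof -
  note k = kernel_boundsD[OF KZ hZ z]
  note [measurable] = k(1) measurable_smoothed[OF hU u]
  note s = nn_integral_smoothed(2,3)[OF hU u]
  show ?thesis
  proof (rule integrable_const_bound[where B = "A / hZ ^ DIM(real^'d) * (A / hU\<^sup>2)"], rule AE_I2)
    fix \<omega>
    have "\<kappa>Z hZ z (Z \<omega>) * smoothed_diagram L w KU hU (D \<omega>) u \<le> A / hZ ^ DIM(real^'d) * (A / hU\<^sup>2)"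
      using k(2,3) s kernel_consts hZ by (intro mult_mono) auto
    then show "norm (\<kappa>Z hZ z (Z \<omega>) * smoothed_diagram L w KU hU (D \<omega>) u) \<le> A / hZ ^ DIM(real^'d) * (A / hU\<^sup>2)"
      using k(2) s(1) by (simp add: abs_mult)
  qed measurable
qed

text \<open>Conditioning on \<open>Z\<close> replaces the smoothed diagram by the integral of the kernel \<open>\<kappa>U\<close> against
  the intensity \<open>lam (Z \<omega>)\<close>. Both kernels vanish outside balls of radius \<open>hZ\<close> and \<open>hU\<close>, and \<open>\<kappa>U\<close> has integral \<open>1\<close>,
  so the expected numerator is the expected denominator times an average of nearby values of \<open>lam\<close>.
  With \<open>m1\<close>, \<open>m2\<close> close to \<open>lam z u\<close> this controls the bias; with the global bounds of \<open>lam\<close> it controls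
  second moments.\<close>

lemma expectation_product_bounds:
  assumes hZ: "0 < hZ" "hZ \<le> h0" and hU: "0 < hU" "hU \<le> h0" and z: "z \<in> \<Z>" and u: "u \<in> Omega_bar L"
    and m1: "0 \<le> m1" and m: "\<And>z' u'. z' \<in> \<Z> \<Longrightarrow> u' \<in> Omega_bar L \<Longrightarrow> norm (z' - z) \<le> hZ \<Longrightarrow> norm (u' - u) \<le> hU
      \<Longrightarrow> m1 \<le> lam z' u' \<and> lam z' u' \<le> m2"
  shows "m1 * expectation (\<lambda>\<omega>. \<kappa>Z hZ z (Z \<omega>))
       \<le> expectation (\<lambda>\<omega>. \<kappa>Z hZ z (Z \<omega>) * smoothed_diagram L w KU hU (D \<omega>) u)"
    and "expectation (\<lambda>\<omega>. \<kappa>Z hZ z (Z \<omega>) * smoothed_diagram L w KU hU (D \<omega>) u)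
       \<le> m2 * expectation (\<lambda>\<omega>. \<kappa>Z hZ z (Z \<omega>))"
proof -
  note k = kernel_boundsD[OF KZ hZ z]
  note kU = kernel_boundsD[OF KU hU u]
  note [measurable] = k(1) kU(1)
  note s = nn_integral_smoothed[OF hU u]
  let ?R = "restrict_space lborel (Omega_bar L)"
  let ?N = "restrict_space borel (Omega_bar L)"
  let ?X = "\<lambda>\<omega>. normalized_measure L w (D \<omega>)"
  let ?g = "\<kappa>Z hZ z"
  \<comment> \<open>extended by \<open>0\<close>, since nothing is known about \<open>lam\<close> off the product domain\<close>
  define l where "l z' u' = ennreal (indicator (\<Z> \<times> Omega_bar L) (z', u') * lam z' u')" for z' u'
  have m2: "0 \<le> m2" using m[OF z u] m1 hZ hU by auto
  have R_sets: "sets ?R = sets ?N" by (intro sets_restrict_space_cong) simp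
  have R_space: "space ?R = Omega_bar L" by (simp add: space_restrict_space)
  have finR: "finite_measure ?R"
  proof (rule finite_measureI)
    have "emeasure lborel (Omega_bar L) < \<infinity>"
      using compact_Omega_bar by (intro emeasure_bounded_finite compact_imp_bounded)
    then show "emeasure ?R (space ?R) \<noteq> \<infinity>"
      unfolding R_space by (subst emeasure_restrict_space) auto
  qed
  have "(\<lambda>x. indicator (\<Z> \<times> Omega_bar L) x *\<^sub>R (case x of (z, u) \<Rightarrow> lam z u)) \<in> borel_measurable borel"
    using compact_\<Z> compact_Omega_bar
    by (intro borel_measurable_continuous_on_indicator lam_continuous borel_closed closed_Times compact_imp_closed)
  then have lam_meas: "(\<lambda>x. ennreal (indicator (\<Z> \<times> Omega_bar L) x *\<^sub>R (case x of (z, u) \<Rightarrow> lam z u)))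
      \<in> borel_measurable (borel \<Otimes>\<^sub>M borel)"
    unfolding borel_prod by measurable
  have idm: "(\<lambda>x. x) \<in> borel \<Otimes>\<^sub>M ?R \<rightarrow>\<^sub>M borel \<Otimes>\<^sub>M borel"
  proof -
    have [measurable]: "(\<lambda>x. x) \<in> ?R \<rightarrow>\<^sub>M borel"
      by (intro measurable_restrict_space1) simp
    have "(\<lambda>x. (fst x, snd x)) \<in> borel \<Otimes>\<^sub>M ?R \<rightarrow>\<^sub>M borel \<Otimes>\<^sub>M (borel :: (real \<times> real) measure)"
      by (intro measurable_Pair measurable_fst measurable_compose[OF measurable_snd]) measurable
    then show ?thesis by simp
  qed
  have l_meas: "(\<lambda>(z, u). l z u) \<in> borel_measurable (borel \<Otimes>\<^sub>M ?R)"
  proof -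
    have "(\<lambda>(z, u). l z u) =
        (\<lambda>x. ennreal (indicator (\<Z> \<times> Omega_bar L) x *\<^sub>R (case x of (z, u) \<Rightarrow> lam z u)))"
      by (auto simp: l_def fun_eq_iff)
    then show ?thesis using measurable_compose[OF idm lam_meas] by simp
  qed
  have dens: "AE \<omega> in P. \<Lambda> (Z \<omega>) = density ?R (l (Z \<omega>)) \<and> emeasure (\<Lambda> (Z \<omega>)) (space ?N) < \<infinity>"
    using AE_in_\<Z>
  proof eventually_elim
    case (elim \<omega>)
    have lz: "l (Z \<omega>) \<in> borel_measurable ?R"
      using measurable_compose[OF measurable_Pair1' l_meas, of "Z \<omega>"] by simp
    have le: "l (Z \<omega>) v = ennreal (lam (Z \<omega>) v)" if "v \<in> space ?R" for v
      using that elim by (simp add: l_def R_space)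
    have "(\<lambda>v. ennreal (lam (Z \<omega>) v)) \<in> borel_measurable ?R"
      by (rule measurable_cong[THEN iffD1, OF le lz])
    then have \<Lambda>l: "\<Lambda> (Z \<omega>) = density ?R (l (Z \<omega>))"
      using lam_density elim density_cong[OF _ lz AE_I2, of "\<lambda>v. ennreal (lam (Z \<omega>) v)"] le by simp
    have "emeasure (\<Lambda> (Z \<omega>)) (space ?N) = emeasure (density ?R (l (Z \<omega>))) (space ?R)"
      using \<Lambda>l sets_eq_imp_space_eq[OF R_sets] by simp
    also have "\<dots> = (\<integral>\<^sup>+v. l (Z \<omega>) v * indicator (space ?R) v \<partial>?R)"
      by (rule emeasure_density[OF lz sets.top])
    also have "\<dots> \<le> (\<integral>\<^sup>+v. ennreal lmax \<partial>?R)"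
      using le lam_le[OF elim] by (intro nn_integral_mono) (auto simp: R_space ennreal_leI)
    also have "\<dots> < \<infinity>"
      using finite_measure.emeasure_finite[OF finR, of "space ?R"] by (simp add: ennreal_mult_less_top less_top)
    finally show ?case using \<Lambda>l by simp
  qed
  have phi: "(\<lambda>v. ennreal (\<kappa>U hU u v)) \<in> borel_measurable ?N"
    by (intro measurable_restrict_space1) measurable
  have X_meas: "(\<lambda>\<omega>. \<integral>\<^sup>+x. \<phi> x \<partial>?X \<omega>) \<in> borel_measurable P" if "\<phi> \<in> borel_measurable ?N" for \<phi>
    using measurable_compose[OF D measurable_nn_integral_normalized[OF w that]] .
  have main: "(\<integral>\<^sup>+\<omega>. ennreal (?g (Z \<omega>)) * (\<integral>\<^sup>+v. ennreal (\<kappa>U hU u v) \<partial>?X \<omega>) \<partial>P) =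
     (\<integral>\<^sup>+\<omega>. ennreal (?g (Z \<omega>)) * (\<integral>\<^sup>+v. ennreal (\<kappa>U hU u v) * l (Z \<omega>) v \<partial>?R) \<partial>P)"
  proof (rule conditional_mean_nn_integral[OF prob_space_axioms Z_meas \<Lambda>, where G = "A / hZ ^ DIM(real^'d)"])
    show "emeasure (?X \<omega>) (space ?N) \<le> 1" for \<omega>
      using normalized_measure_le_1[OF w] by (simp add: space_restrict_space)
    show "sigma_finite_measure ?R"
      using finR by (simp add: finite_measure_def)
  qed (use R_sets l_meas dens k(1,2,3) phi X_meas in \<open>auto simp: sets_normalized_measure\<close>)
  have "(\<integral>\<^sup>+v. ennreal (\<kappa>U hU u v) \<partial>?R) = (\<integral>\<^sup>+v. ennreal (indicator (Omega_bar L) v * \<kappa>U hU u v) \<partial>lborel)"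
    by (subst nn_integral_restrict_space) (auto intro!: nn_integral_cong split: split_indicator)
  also have "\<dots> = ennreal (LINT v:Omega_bar L|lborel. \<kappa>U hU u v)"
  proof -
    have "set_integrable lborel (Omega_bar L) (\<kappa>U hU u)"
      using kU(5) not_integrable_integral_eq[of lborel "\<lambda>y. indicator (Omega_bar L) y *\<^sub>R \<kappa>U hU u y"]
      unfolding set_integrable_def set_lebesgue_integral_def by fastforce
    then show ?thesis
      unfolding set_integrable_def set_lebesgue_integral_def using kU(2)
      by (subst nn_integral_eq_integral) auto
  qed
  finally have one: "(\<integral>\<^sup>+v. ennreal (\<kappa>U hU u v) \<partial>?R) = 1" using kU(5) by simp
  have [measurable]: "(\<lambda>v. ennreal (\<kappa>U hU u v)) \<in> borel_measurable ?R"
    using phi R_sets by (simp cong: measurable_cong_sets)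
  have inner: "ennreal (?g z') * ennreal m1 \<le> ennreal (?g z') * (\<integral>\<^sup>+v. ennreal (\<kappa>U hU u v) * l z' v \<partial>?R) \<and>
      ennreal (?g z') * (\<integral>\<^sup>+v. ennreal (\<kappa>U hU u v) * l z' v \<partial>?R) \<le> ennreal (?g z') * ennreal m2"
    if z': "z' \<in> \<Z>" for z'
  proof (cases "norm (z' - z) \<le> hZ")
    case True
    have lv: "ennreal (\<kappa>U hU u v) * ennreal m1 \<le> ennreal (\<kappa>U hU u v) * l z' v \<and>
        ennreal (\<kappa>U hU u v) * l z' v \<le> ennreal (\<kappa>U hU u v) * ennreal m2" if v: "v \<in> space ?R" for v
    proof (cases "norm (v - u) \<le> hU")
      case True
      then show ?thesis
        using m[OF z' _ \<open>norm (z' - z) \<le> hZ\<close> True] v z'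
        by (auto simp: l_def R_space ennreal_leI intro!: mult_left_mono)
    next
      case False
      then show ?thesis using kU(4)[of v] by simp
    qed
    have "ennreal m1 = (\<integral>\<^sup>+v. ennreal (\<kappa>U hU u v) * ennreal m1 \<partial>?R)"
      using one by (simp add: nn_integral_multc)
    also have "\<dots> \<le> (\<integral>\<^sup>+v. ennreal (\<kappa>U hU u v) * l z' v \<partial>?R)"
      using lv by (intro nn_integral_mono) auto
    finally have 1: "ennreal m1 \<le> (\<integral>\<^sup>+v. ennreal (\<kappa>U hU u v) * l z' v \<partial>?R)" .
    have "(\<integral>\<^sup>+v. ennreal (\<kappa>U hU u v) * l z' v \<partial>?R) \<le> (\<integral>\<^sup>+v. ennreal (\<kappa>U hU u v) * ennreal m2 \<partial>?R)"
      using lv by (intro nn_integral_mono) auto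
    also have "\<dots> = ennreal m2" using one by (simp add: nn_integral_multc)
    finally show ?thesis using 1 by (auto intro!: mult_left_mono)
  next
    case False
    then show ?thesis using k(4)[of z'] by simp
  qed
  have lhs: "(\<integral>\<^sup>+\<omega>. ennreal (?g (Z \<omega>)) * (\<integral>\<^sup>+v. ennreal (\<kappa>U hU u v) \<partial>?X \<omega>) \<partial>P)
      = ennreal (expectation (\<lambda>\<omega>. ?g (Z \<omega>) * smoothed_diagram L w KU hU (D \<omega>) u))"
    unfolding s(1) using k(2) s(2) integrable_product[OF hZ hU z u]
    by (subst nn_integral_eq_integral[symmetric]) (auto simp: ennreal_mult)
  have gm: "(\<integral>\<^sup>+\<omega>. ennreal (?g (Z \<omega>)) * ennreal c \<partial>P) = ennreal (c * expectation (\<lambda>\<omega>. ?g (Z \<omega>)))"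
    if "0 \<le> c" for c
  proof -
    have "(\<integral>\<^sup>+\<omega>. ennreal (?g (Z \<omega>)) * ennreal c \<partial>P) = (\<integral>\<^sup>+\<omega>. ennreal (?g (Z \<omega>)) \<partial>P) * ennreal c"
      by (rule nn_integral_multc) measurable
    also have "(\<integral>\<^sup>+\<omega>. ennreal (?g (Z \<omega>)) \<partial>P) = ennreal (expectation (\<lambda>\<omega>. ?g (Z \<omega>)))"
      using expectation_kernel(3)[OF hZ z] k(2) by (intro nn_integral_eq_integral) auto
    finally show ?thesis using that by (simp add: ennreal_mult' mult.commute)
  qed
  have nn: "0 \<le> expectation (\<lambda>\<omega>. ?g (Z \<omega>))"
    "0 \<le> expectation (\<lambda>\<omega>. ?g (Z \<omega>) * smoothed_diagram L w KU hU (D \<omega>) u)"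
    using k(2) s(2) by (auto intro!: integral_nonneg_AE)
  have "ennreal (m1 * expectation (\<lambda>\<omega>. ?g (Z \<omega>)))
      \<le> ennreal (expectation (\<lambda>\<omega>. ?g (Z \<omega>) * smoothed_diagram L w KU hU (D \<omega>) u))"
    unfolding gm[OF m1, symmetric] lhs[symmetric] main
    using AE_in_\<Z> inner by (intro nn_integral_mono_AE) auto
  then show "m1 * expectation (\<lambda>\<omega>. ?g (Z \<omega>))
      \<le> expectation (\<lambda>\<omega>. ?g (Z \<omega>) * smoothed_diagram L w KU hU (D \<omega>) u)"
    using nn by (simp add: ennreal_le_iff)
  have "ennreal (expectation (\<lambda>\<omega>. ?g (Z \<omega>) * smoothed_diagram L w KU hU (D \<omega>) u))
      \<le> ennreal (m2 * expectation (\<lambda>\<omega>. ?g (Z \<omega>)))"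
    unfolding gm[OF m2, symmetric] lhs[symmetric] main
    using AE_in_\<Z> inner by (intro nn_integral_mono_AE) auto
  then show "expectation (\<lambda>\<omega>. ?g (Z \<omega>) * smoothed_diagram L w KU hU (D \<omega>) u)
      \<le> m2 * expectation (\<lambda>\<omega>. ?g (Z \<omega>))"
    using nn m2 by (simp add: ennreal_le_iff)
qed

end

section \<open>Uniform deviation of kernel averages\<close>

context intensity_model
begin

text \<open>With \<open>b = hZ\<^sup>d hU\<^sup>2\<close>, the summands of the numerator and of the denominator are of order
  \<open>1 / b\<close>, and so are their second moments: a second moment is at most the sup norm times a mean
  of order \<open>1\<close>, rather than the square of the sup norm. Bernstein with \<open>s = b t / V\<close> then
  gives a deviation of order \<open>t\<close> with failure probability \<open>exp (- c t\<^sup>2 n b)\<close> per point of the net. If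
  \<open>t\<^sup>2 n b\<close> exceeds \<open>ln (n / (\<delta> b))\<close>, this is at most a power of \<open>\<delta> / n\<close>, which absorbs the polynomial
  cardinality \<open>n\<^sup>q\<close> of the net. The net is polynomial in \<open>n\<close> because \<open>n b \<ge> 1\<close> forces
  \<open>hZ, hU \<ge> 1 / n\<close>.\<close>

lemma kernel_averages_deviation:
  obtains H N0 where "0 < H" and
    "\<And>(M::'m measure) Zs Ds n hZ hU \<delta> t.
     iid_copies P (borel \<Otimes>\<^sub>M diagram_space L) (\<lambda>\<omega>. (Z \<omega>, D \<omega>)) M (\<lambda>i \<omega>. (Zs i \<omega>, Ds i \<omega>)) \<Longrightarrow>
     N0 \<le> n \<Longrightarrow> 0 < hZ \<Longrightarrow> hZ \<le> h0 \<Longrightarrow> 0 < hU \<Longrightarrow> hU \<le> h0 \<Longrightarrow>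
     1 \<le> real n * hZ ^ CARD('d) * hU\<^sup>2 \<Longrightarrow> 0 < \<delta> \<Longrightarrow> \<delta> < 1 \<Longrightarrow> 0 < t \<Longrightarrow> t \<le> 1 \<Longrightarrow>
     ln (real n / (\<delta> * hZ ^ CARD('d) * hU\<^sup>2)) \<le> t\<^sup>2 * (real n * hZ ^ CARD('d) * hU\<^sup>2) \<Longrightarrow>
     (\<exists>E\<in>sets M. 1 - \<delta> \<le> measure M E \<and> (\<forall>\<omega>\<in>E. \<forall>z\<in>\<Z>.
        \<bar>(\<Sum>i=1..n. \<kappa>Z hZ z (Zs i \<omega>)) / n - expectation (\<lambda>\<omega>. \<kappa>Z hZ z (Z \<omega>))\<bar> \<le> H * t \<and>
        (\<forall>u\<in>Omega_bar L.
          \<bar>(\<Sum>i=1..n. \<kappa>Z hZ z (Zs i \<omega>) * smoothed_diagram L w KU hU (Ds i \<omega>) u) / n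
            - expectation (\<lambda>\<omega>. \<kappa>Z hZ z (Z \<omega>) * smoothed_diagram L w KU hU (D \<omega>) u)\<bar> \<le> H * t)))"
proof -
  let ?d = "CARD('d)"
  have d1: "1 \<le> ?d" by (simp add: Suc_leI)
  obtain z1 where z1: "z1 \<in> \<Z>" using \<Z>_nonempty by auto
  have CZ: "0 < CZ" using z1 pZ cZ by fastforce
  obtain A2 where A2: "0 < A2" "\<And>\<epsilon>. 0 < \<epsilon> \<Longrightarrow> \<epsilon> \<le> 1 \<Longrightarrow>
      \<exists>T\<subseteq>\<Z>. finite T \<and> card T \<le> A2 / \<epsilon> ^ DIM(real^'d) \<and> (\<forall>x\<in>\<Z>. \<exists>t\<in>T. norm (x - t) \<le> \<epsilon>)"
    using small_net[OF compact_imp_bounded[OF compact_\<Z>]] by metis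
  obtain A3 where A3: "0 < A3" "\<And>\<epsilon>. 0 < \<epsilon> \<Longrightarrow> \<epsilon> \<le> 1 \<Longrightarrow>
      \<exists>T\<subseteq>Omega_bar L. finite T \<and> card T \<le> A3 / \<epsilon> ^ DIM(real \<times> real) \<and> (\<forall>x\<in>Omega_bar L. \<exists>t\<in>T. norm (x - t) \<le> \<epsilon>)"
    using small_net[OF compact_imp_bounded[OF compact_Omega_bar]] by metis
  define lm where "lm = max lmax 0"
  have lm: "0 \<le> lm" "lmax \<le> lm" by (auto simp: lm_def)
  \<comment> \<open>\<open>V / b\<close> bounds sup norms and second moments; \<open>q\<close> is the exponent of the net cardinality; \<open>E0\<close> is
    chosen so that the exponent in Bernstein's inequality becomes \<open>- (q + 2) t\<^sup>2 n b\<close>; \<open>\<eta>0 / n\<close> is the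
    discretization error; \<open>N0\<close> makes \<open>2 A4 \<le> n\<^sup>2\<close> and \<open>ln n \<ge> 1\<close>\<close>
  define V where "V = 1 + (A + A\<^sup>2) * (1 + CZ + lm * CZ)"
  have V: "0 < V" "A \<le> V" "A\<^sup>2 \<le> V" "A * CZ \<le> V" "A\<^sup>2 * (lm * CZ) \<le> V"
    using kernel_consts CZ lm by (auto simp: V_def algebra_simps intro!: add_nonneg_nonneg add_pos_nonneg)
  define q where "q = (2 * ?d + 6) * (?d + 2)"
  define E0 where "E0 = 1 + V * (q + 2)"
  define A4 where "A4 = A2 + A2 * A3"
  define \<eta>0 where "\<eta>0 = A + 2 * A\<^sup>2"
  define H where "H = E0 + 2 * \<eta>0"
  have H: "0 < H" using V kernel_consts by (auto simp: H_def E0_def \<eta>0_def intro!: add_pos_nonneg)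
  define N0 where "N0 = max 3 (nat \<lceil>2 * A4\<rceil>)"
  let ?S = "borel \<Otimes>\<^sub>M diagram_space L :: ((real^'d) \<times> diagram) measure"
  let ?Y = "smoothed_diagram L w KU"
  {
    fix M :: "'m measure" and Zs Ds n hZ hU \<delta> t
    assume iid: "iid_copies P ?S (\<lambda>\<omega>. (Z \<omega>, D \<omega>)) M (\<lambda>i \<omega>. (Zs i \<omega>, Ds i \<omega>))"
      and n: "N0 \<le> n" and hZ: "0 < hZ" "hZ \<le> h0" and hU: "0 < hU" "hU \<le> h0"
      and N1: "1 \<le> real n * hZ ^ ?d * hU\<^sup>2" and \<delta>: "0 < \<delta>" "\<delta> < 1" and t: "0 < t" "t \<le> 1"
      and ln_le: "ln (real n / (\<delta> * hZ ^ ?d * hU\<^sup>2)) \<le> t\<^sup>2 * (real n * hZ ^ ?d * hU\<^sup>2)"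
    define b where "b = hZ ^ ?d * hU\<^sup>2"
    have h1: "hZ \<le> 1" "hU \<le> 1" using hZ hU kernel_consts by auto
    have n3: "3 \<le> n" "2 * A4 \<le> n" using n by (auto simp: N0_def nat_le_iff ceiling_le_iff)
    have b: "0 < b" "b \<le> 1" "b \<le> hZ ^ ?d" "b \<le> hU\<^sup>2"
      using hZ hU h1 by (auto simp: b_def mult_le_one power_le_one mult_left_le mult_left_le_one_le)
    have N1': "1 \<le> n * b" using N1 by (simp add: b_def mult.assoc)
    have bn: "1 / n \<le> b" using N1' n3 by (simp add: divide_le_eq mult.commute)
    have "hZ ^ ?d \<le> hZ ^ 1" using hZ h1 d1 by (intro power_decreasing) auto
    then have hZn: "1 / n \<le> hZ" using bn b by simp
    have "hU\<^sup>2 \<le> hU ^ 1" using hU h1 by (intro power_decreasing) auto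
    then have hUn: "1 / n \<le> hU" using bn b by simp
    have inv_pow: "1 / h ^ m \<le> real n ^ m" if "1 / n \<le> h" for h :: real and m
    proof -
      have "(1 / n) ^ m \<le> h ^ m" using that by (intro power_mono) auto
      moreover have "0 < h" using that n3 by (smt (verit) divide_pos_pos of_nat_0_less_iff zero_less_numeral order_less_le_trans)
      ultimately show ?thesis using n3 by (simp add: field_simps power_divide)
    qed
    \<comment> \<open>the discretization error \<open>1 / n\<close> is dominated by the stochastic error \<open>t\<close>\<close>
    have t_ge: "1 / n \<le> t"
    proof -
      have "exp 1 \<le> (3::real)" by (rule exp_le)
      then have "1 \<le> ln (real n)" using n3 by (subst ln_ge_iff) auto
      also have "\<dots> \<le> ln (n / (\<delta> * hZ ^ ?d * hU\<^sup>2))"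
      proof (rule ln_mono)
        have "\<delta> * b \<le> 1" using \<delta> b by (simp add: mult_le_one)
        moreover have "0 < \<delta> * b" using \<delta> b by simp
        ultimately show "real n \<le> n / (\<delta> * hZ ^ ?d * hU\<^sup>2)"
          using n3 by (simp add: b_def mult.assoc le_divide_eq mult_left_le)
      qed (use n3 in auto)
      also have "\<dots> \<le> t\<^sup>2 * (n * b)" using ln_le by (simp add: b_def mult.assoc)
      also have "\<dots> \<le> t * n"
        using t b n3 by (intro mult_mono) (auto simp: power2_eq_square mult_left_le)
      finally show ?thesis using n3 by (simp add: divide_le_eq)
    qed
    have M: "prob_space M" using iid by (simp add: iid_copies_def)
    interpret M: prob_space M by (rule M)
    let ?Q = "distr P ?S (\<lambda>\<omega>. (Z \<omega>, D \<omega>))"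
    let ?\<xi> = "\<lambda>i \<omega>. (Zs i \<omega>, Ds i \<omega>)"
    have ZD [measurable]: "(\<lambda>\<omega>. (Z \<omega>, D \<omega>)) \<in> P \<rightarrow>\<^sub>M ?S" by measurable
    define f1 where "f1 z = (\<lambda>x::(real^'d) \<times> diagram. \<kappa>Z hZ z (fst x))" for z
    define f2 where "f2 z u = (\<lambda>x::(real^'d) \<times> diagram. \<kappa>Z hZ z (fst x) * ?Y hU (snd x) u)" for z u
    have f1_meas: "f1 z \<in> borel_measurable ?S" if "z \<in> \<Z>" for z
      unfolding f1_def using kernel_boundsD(1)[OF KZ hZ that] by measurable
    have f2_meas: "f2 z u \<in> borel_measurable ?S" if "z \<in> \<Z>" "u \<in> Omega_bar L" for z u
      unfolding f2_def using kernel_boundsD(1)[OF KZ hZ that(1)] measurable_smoothed[OF hU that(2)] by measurable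
    have f1_bd: "0 \<le> f1 z x" "f1 z x \<le> A / b" if "z \<in> \<Z>" for z x
    proof -
      show "0 \<le> f1 z x" using kernel_boundsD(2)[OF KZ hZ that] by (simp add: f1_def)
      have "f1 z x \<le> A / hZ ^ ?d" using kernel_boundsD(3)[OF KZ hZ that] by (simp add: f1_def)
      also have "\<dots> \<le> A / b" using b hZ kernel_consts by (intro divide_left_mono) auto
      finally show "f1 z x \<le> A / b" .
    qed
    have f2_bd: "0 \<le> f2 z u x" "f2 z u x \<le> A\<^sup>2 / b" if "z \<in> \<Z>" "u \<in> Omega_bar L" for z u x
    proof -
      note k = kernel_boundsD(2,3)[OF KZ hZ that(1), of "fst x"] and y = nn_integral_smoothed(2,3)[OF hU that(2), of "snd x"]
      show "0 \<le> f2 z u x" using k y by (simp add: f2_def)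
      have "f2 z u x \<le> A / hZ ^ DIM(real^'d) * (A / hU\<^sup>2)"
        unfolding f2_def using k y kernel_consts hZ by (intro mult_mono) auto
      then show "f2 z u x \<le> A\<^sup>2 / b" by (simp add: b_def power2_eq_square)
    qed
    have f1_int: "(\<integral>x. f1 z x \<partial>?Q) = expectation (\<lambda>\<omega>. \<kappa>Z hZ z (Z \<omega>))" if "z \<in> \<Z>" for z
      using integral_distr[OF ZD f1_meas[OF that]] by (simp add: f1_def)
    have f2_int: "(\<integral>x. f2 z u x \<partial>?Q) = expectation (\<lambda>\<omega>. \<kappa>Z hZ z (Z \<omega>) * ?Y hU (D \<omega>) u)"
      if "z \<in> \<Z>" "u \<in> Omega_bar L" for z u
      using integral_distr[OF ZD f2_meas[OF that]] by (simp add: f2_def)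
    interpret Q: prob_space ?Q by (rule prob_space_distr[OF ZD])
    have second: "(\<integral>x. (f x)\<^sup>2 \<partial>?Q) \<le> c * (\<integral>x. f x \<partial>?Q)"
      if "f \<in> borel_measurable ?S" and bd: "\<And>x. 0 \<le> f x" "\<And>x. f x \<le> c" for f :: "(real^'d) \<times> diagram \<Rightarrow> real" and c
    proof -
      have [measurable]: "f \<in> borel_measurable ?Q" using that by simp
      have i: "integrable ?Q f" using bd by (intro Q.integrable_const_bound[where B = c]) auto
      have "(\<integral>x. (f x)\<^sup>2 \<partial>?Q) \<le> (\<integral>x. c * f x \<partial>?Q)"
      proof (rule integral_mono)
        show "(f x)\<^sup>2 \<le> c * f x" for x using bd by (simp add: power2_eq_square mult_right_mono)
        show "integrable ?Q (\<lambda>x. (f x)\<^sup>2)"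
          using bd by (intro Q.integrable_const_bound[where B = "c\<^sup>2"]) (auto intro!: power_mono)
      qed (use i in simp)
      then show ?thesis by simp
    qed
    define F where "F = f1 ` \<Z> \<union> (\<lambda>(z, u). f2 z u) ` (\<Z> \<times> Omega_bar L)"
    have F_cases: "(\<And>z. z \<in> \<Z> \<Longrightarrow> f = f1 z \<Longrightarrow> thesis) \<Longrightarrow>
        (\<And>z u. z \<in> \<Z> \<Longrightarrow> u \<in> Omega_bar L \<Longrightarrow> f = f2 z u \<Longrightarrow> thesis) \<Longrightarrow> thesis" if "f \<in> F" for f thesis
      using that by (auto simp: F_def)
    \<comment> \<open>the mesh: Lipschitz constants are at most of order \<open>n ^ (2 d + 5)\<close>, so the error is of order \<open>1 / n\<close>\<close>
    define e where "e = 1 / real n ^ (2 * ?d + 6)"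
    have e: "0 < e" "e \<le> 1" using n3 by (auto simp: e_def)
    obtain T1 where T1: "T1 \<subseteq> \<Z>" "finite T1" "card T1 \<le> A2 / e ^ DIM(real^'d)"
      "\<And>x. x \<in> \<Z> \<Longrightarrow> \<exists>y\<in>T1. norm (x - y) \<le> e" using A2(2)[OF e] by blast
    obtain T2 where T2: "T2 \<subseteq> Omega_bar L" "finite T2" "card T2 \<le> A3 / e ^ DIM(real \<times> real)"
      "\<And>x. x \<in> Omega_bar L \<Longrightarrow> \<exists>y\<in>T2. norm (x - y) \<le> e" using A3(2)[OF e] by blast
    define T where "T = f1 ` T1 \<union> (\<lambda>(z, u). f2 z u) ` (T1 \<times> T2)"
    have fin_T: "finite T" and T_F: "T \<subseteq> F" using T1 T2 by (auto simp: T_def F_def)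
    have card_T: "card T \<le> A4 * real n ^ q"
    proof -
      have "card T \<le> card (f1 ` T1) + card ((\<lambda>(z, u). f2 z u) ` (T1 \<times> T2))"
        unfolding T_def by (rule card_Un_le)
      also have "\<dots> \<le> card T1 + card (T1 \<times> T2)"
        using T1 T2 by (intro add_mono card_image_le) auto
      finally have "real (card T) \<le> card T1 + real (card T1) * card T2"
        by (simp add: card_cartesian_product flip: of_nat_mult of_nat_add)
      also have "\<dots> \<le> A2 * real n ^ q + A2 * A3 * real n ^ q"
      proof (rule add_mono)
        have c1: "card T1 \<le> A2 * real n ^ ((2 * ?d + 6) * ?d)"
          using T1(3) by (simp add: e_def power_divide power_mult)
        have c2: "card T2 \<le> A3 * real n ^ ((2 * ?d + 6) * 2)"
          using T2(3) by (simp add: e_def power_divide power2_eq_square flip: power_add)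
        have "A2 * real n ^ ((2 * ?d + 6) * ?d) \<le> A2 * real n ^ q"
          using A2 n3 by (intro mult_left_mono power_increasing) (auto simp: q_def)
        then show "card T1 \<le> A2 * real n ^ q" using c1 by simp
        have "real (card T1) * card T2 \<le> (A2 * real n ^ ((2 * ?d + 6) * ?d)) * (A3 * real n ^ ((2 * ?d + 6) * 2))"
          using c1 c2 A2 A3 by (intro mult_mono) auto
        also have "\<dots> = A2 * A3 * real n ^ q"
          by (simp add: q_def power_add[symmetric] distrib_left add_ac)
        finally show "real (card T1) * card T2 \<le> A2 * A3 * real n ^ q" .
      qed
      finally show ?thesis by (simp add: A4_def algebra_simps)
    qed
    have kZ_lip: "\<bar>\<kappa>Z hZ z x - \<kappa>Z hZ y x\<bar> \<le> A * real n ^ (2 * ?d + 1) * e"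
      if "z \<in> \<Z>" "y \<in> \<Z>" "norm (z - y) \<le> e" for z y x
    proof -
      have "\<bar>\<kappa>Z hZ z x - \<kappa>Z hZ y x\<bar> \<le> A * (1 / hZ ^ (2 * ?d + 1)) * norm (z - y)"
        using kernel_boundsD(6)[OF KZ hZ that(1,2), of x] by simp
      also have "\<dots> \<le> A * real n ^ (2 * ?d + 1) * e"
        using that inv_pow[OF hZn, of "2 * ?d + 1"] kernel_consts hZ by (intro mult_mono) auto
      finally show ?thesis .
    qed
    have Y_lip: "\<bar>?Y hU a u - ?Y hU a v\<bar> \<le> A * real n ^ 5 * e"
      if "u \<in> Omega_bar L" "v \<in> Omega_bar L" "norm (u - v) \<le> e" for u v a
    proof -
      have "\<bar>?Y hU a u - ?Y hU a v\<bar> \<le> A * (1 / hU ^ 5) * norm (u - v)"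
        using smoothed_lipschitz[OF hU that(1,2), of a] by simp
      also have "\<dots> \<le> A * real n ^ 5 * e"
        using that inv_pow[OF hUn, of 5] kernel_consts hU by (intro mult_mono) auto
      finally show ?thesis .
    qed
    have ne: "real n ^ m * e \<le> 1 / n" if "m \<le> 2 * ?d + 5" for m
    proof -
      have "real n ^ m * e \<le> real n ^ (2 * ?d + 5) * e"
        using that n3 e by (intro mult_right_mono power_increasing) auto
      also have "\<dots> = 1 / n" using n3 by (simp add: e_def field_simps power_add numeral_eq_Suc)
      finally show ?thesis .
    qed
    have net: "\<exists>g\<in>T. \<forall>x\<in>space ?S. \<bar>f x - g x\<bar> \<le> \<eta>0 / n" if "f \<in> F" for f
      using that
    proof (rule F_cases)
      fix z assume z: "z \<in> \<Z>" and f: "f = f1 z"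
      obtain y where y: "y \<in> T1" "norm (z - y) \<le> e" using T1(4)[OF z] by blast
      have "\<bar>f1 z x - f1 y x\<bar> \<le> \<eta>0 / n" for x
      proof -
        have "\<bar>f1 z x - f1 y x\<bar> \<le> A * (real n ^ (2 * ?d + 1) * e)"
          using kZ_lip[OF z _ y(2)] y T1 by (auto simp: f1_def mult.assoc)
        also have "\<dots> \<le> A * (1 / n)" using kernel_consts ne[of "2 * ?d + 1"] by (intro mult_left_mono) auto
        also have "\<dots> \<le> \<eta>0 / n" by (simp add: \<eta>0_def divide_right_mono)
        finally show ?thesis .
      qed
      then show ?thesis using y f by (auto simp: T_def intro!: bexI[of _ "f1 y"])
    next
      fix z u assume z: "z \<in> \<Z>" and u: "u \<in> Omega_bar L" and f: "f = f2 z u"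
      obtain y where y: "y \<in> T1" "norm (z - y) \<le> e" using T1(4)[OF z] by blast
      obtain v where v: "v \<in> T2" "norm (u - v) \<le> e" using T2(4)[OF u] by blast
      have yZ: "y \<in> \<Z>" and vO: "v \<in> Omega_bar L" using y v T1 T2 by auto
      have "\<bar>f2 z u x - f2 y v x\<bar> \<le> \<eta>0 / n" for x
      proof -
        note Yb = nn_integral_smoothed(2,3)[OF hU u, of "snd x"]
        note kb = kernel_boundsD(2,3)[OF KZ hZ yZ, of "fst x"]
        have Y1: "?Y hU (snd x) u \<le> A * real n ^ 2"
          using order_trans[OF Yb(2), of "A * real n ^ 2"] inv_pow[OF hUn, of 2] kernel_consts
            mult_left_mono[OF inv_pow[OF hUn, of 2], of A] by simp
        have k1: "\<kappa>Z hZ y (fst x) \<le> A * real n ^ ?d"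
          using order_trans[OF kb(2), of "A * real n ^ ?d"] kernel_consts
            mult_left_mono[OF inv_pow[OF hZn, of ?d], of A] by simp
        have "f2 z u x - f2 y v x = (\<kappa>Z hZ z (fst x) - \<kappa>Z hZ y (fst x)) * ?Y hU (snd x) u
            + \<kappa>Z hZ y (fst x) * (?Y hU (snd x) u - ?Y hU (snd x) v)"
          by (simp add: f2_def algebra_simps)
        then have "\<bar>f2 z u x - f2 y v x\<bar> \<le> \<bar>\<kappa>Z hZ z (fst x) - \<kappa>Z hZ y (fst x)\<bar> * ?Y hU (snd x) u
            + \<kappa>Z hZ y (fst x) * \<bar>?Y hU (snd x) u - ?Y hU (snd x) v\<bar>"
          using Yb kb abs_triangle_ineq[of "(\<kappa>Z hZ z (fst x) - \<kappa>Z hZ y (fst x)) * ?Y hU (snd x) u"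
              "\<kappa>Z hZ y (fst x) * (?Y hU (snd x) u - ?Y hU (snd x) v)"]
          by (simp add: abs_mult)
        also have "\<dots> \<le> (A * real n ^ (2 * ?d + 1) * e) * (A * real n ^ 2) + (A * real n ^ ?d) * (A * real n ^ 5 * e)"
          using kZ_lip[OF z yZ y(2)] Y_lip[OF u vO v(2)] Yb kb Y1 k1 kernel_consts e
          by (intro add_mono mult_mono) auto
        also have "\<dots> = A\<^sup>2 * (real n ^ (2 * ?d + 3) * e) + A\<^sup>2 * (real n ^ (?d + 5) * e)"
          by (simp add: power_add power2_eq_square numeral_eq_Suc)
        also have "\<dots> \<le> A\<^sup>2 * (1 / n) + A\<^sup>2 * (1 / n)"
          using ne[of "2 * ?d + 3"] ne[of "?d + 5"] by (intro add_mono mult_left_mono) auto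
        also have "\<dots> \<le> \<eta>0 / n" using kernel_consts by (simp add: \<eta>0_def add_divide_distrib)
        finally show ?thesis .
      qed
      then show ?thesis using y v f by (auto simp: T_def intro!: bexI[of _ "f2 y v"])
    qed
    define s where "s = b * t / V"
    have s: "0 < s" "s * (V / b) \<le> 1" using b t V by (auto simp: s_def)
    have "\<exists>E\<in>M.events. 1 - 2 * card T * exp (n * (s\<^sup>2 * (V / b) - s * (E0 * t))) \<le> M.prob E \<and>
      (\<forall>\<omega>\<in>E. \<omega> \<in> space M \<and> (\<forall>f\<in>F. \<bar>(\<Sum>i=1..n. f (?\<xi> i \<omega>)) / n - (\<integral>x. f x \<partial>?Q)\<bar> \<le> E0 * t + 2 * (\<eta>0 / n)))"
    proof (rule M.uniform_deviation[OF _ _ _ _ _ fin_T T_F net s])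
      show "M.indep_vars (\<lambda>_. ?S) ?\<xi> {1..n}"
        using iid by (auto simp: iid_copies_def intro: M.indep_vars_subset)
      show "distr M ?S (?\<xi> i) = ?Q" if "i \<in> {1..n}" for i
        using iid that by (auto simp: iid_copies_def)
      fix f assume f: "f \<in> F"
      show "f \<in> borel_measurable ?S" using f by (rule F_cases) (auto simp: f1_meas f2_meas)
      show "\<bar>f x\<bar> \<le> V / b" for x using f
      proof (rule F_cases)
        fix z assume "z \<in> \<Z>" "f = f1 z"
        then have "\<bar>f x\<bar> \<le> A / b" using f1_bd[of z x] by simp
        also have "\<dots> \<le> V / b" using V b by (intro divide_right_mono) auto
        finally show ?thesis .
      next
        fix z u assume "z \<in> \<Z>" "u \<in> Omega_bar L" "f = f2 z u"
        then have "\<bar>f x\<bar> \<le> A\<^sup>2 / b" using f2_bd[of z u x] by simp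
        also have "\<dots> \<le> V / b" using V b by (intro divide_right_mono) auto
        finally show ?thesis .
      qed
      show "(\<integral>x. (f x)\<^sup>2 \<partial>?Q) \<le> V / b" using f
      proof (rule F_cases)
        fix z assume z: "z \<in> \<Z>" and fz: "f = f1 z"
        have "(\<integral>x. (f x)\<^sup>2 \<partial>?Q) \<le> A / b * (\<integral>x. f x \<partial>?Q)"
          unfolding fz using f1_bd[OF z] by (intro second f1_meas[OF z]) auto
        also have "\<dots> \<le> A / b * CZ"
          unfolding fz f1_int[OF z] using kernel_consts b expectation_kernel(2)[OF hZ z]
          by (intro mult_left_mono) auto
        also have "\<dots> \<le> V / b" using V b by (simp add: divide_right_mono)
        finally show ?thesis .
      next
        fix z u assume z: "z \<in> \<Z>" and u: "u \<in> Omega_bar L" and fz: "f = f2 z u"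
        have "expectation (\<lambda>\<omega>. \<kappa>Z hZ z (Z \<omega>) * ?Y hU (D \<omega>) u) \<le> lm * expectation (\<lambda>\<omega>. \<kappa>Z hZ z (Z \<omega>))"
        proof (rule expectation_product_bounds(2)[OF hZ hU z u, of 0])
          show "0 \<le> lam z' u' \<and> lam z' u' \<le> lm" if "z' \<in> \<Z>" "u' \<in> Omega_bar L" for z' u'
            using lam_nonneg[OF that] lam_le[OF that] lm by simp
        qed simp
        also have "\<dots> \<le> lm * CZ" using lm expectation_kernel(2)[OF hZ z] by (intro mult_left_mono) auto
        finally have E2: "(\<integral>x. f x \<partial>?Q) \<le> lm * CZ" unfolding fz f2_int[OF z u] .
        have "(\<integral>x. (f x)\<^sup>2 \<partial>?Q) \<le> A\<^sup>2 / b * (\<integral>x. f x \<partial>?Q)"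
          unfolding fz using f2_bd[OF z u] by (intro second f2_meas[OF z u]) auto
        also have "\<dots> \<le> A\<^sup>2 / b * (lm * CZ)"
          using E2 kernel_consts b by (intro mult_left_mono) auto
        also have "\<dots> \<le> V / b" using V b by (simp add: divide_right_mono)
        finally show ?thesis .
      qed
    qed (use n3 in auto)
    then obtain E where E: "E \<in> M.events"
      "1 - 2 * card T * exp (n * (s\<^sup>2 * (V / b) - s * (E0 * t))) \<le> M.prob E"
      "\<And>\<omega> f. \<omega> \<in> E \<Longrightarrow> f \<in> F \<Longrightarrow>
         \<bar>(\<Sum>i=1..n. f (?\<xi> i \<omega>)) / n - (\<integral>x. f x \<partial>?Q)\<bar> \<le> E0 * t + 2 * (\<eta>0 / n)"
      by auto
    have "n * (s\<^sup>2 * (V / b) - s * (E0 * t)) = - (real (q + 2) * (t\<^sup>2 * (n * b)))"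
      using V b by (simp add: s_def E0_def field_simps power2_eq_square)
    also have "\<dots> \<le> - (real (q + 2) * ln (n / \<delta>))"
    proof -
      have "ln (n / \<delta>) \<le> ln (n / (\<delta> * hZ ^ ?d * hU\<^sup>2))"
      proof (rule ln_mono)
        have "\<delta> * b \<le> \<delta>" using \<delta> b by (simp add: mult_left_le)
        then have "n / \<delta> \<le> n / (\<delta> * b)" using \<delta> b by (intro divide_left_mono) auto
        then show "n / \<delta> \<le> n / (\<delta> * hZ ^ ?d * hU\<^sup>2)" by (simp add: b_def mult.assoc)
      qed (use n3 \<delta> in auto)
      also have "\<dots> \<le> t\<^sup>2 * (n * b)" using ln_le by (simp add: b_def mult.assoc)
      finally show ?thesis by (intro le_imp_neg_le mult_left_mono) auto
    qed
    finally have "exp (n * (s\<^sup>2 * (V / b) - s * (E0 * t))) \<le> exp (- (real (q + 2) * ln (n / \<delta>)))" by simp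
    also have "\<dots> = (\<delta> / n) ^ (q + 2)"
    proof -
      have "exp (real (q + 2) * ln (n / \<delta>)) = (n / \<delta>) ^ (q + 2)"
        unfolding exp_of_nat_mult using n3 \<delta> by simp
      then show ?thesis by (simp add: exp_minus power_divide)
    qed
    also have "\<dots> \<le> \<delta> / real n ^ (q + 2)"
    proof -
      have "\<delta> ^ (q + 2) \<le> \<delta> ^ 1" using \<delta> by (intro power_decreasing) auto
      then show ?thesis by (simp add: power_divide divide_right_mono)
    qed
    finally have exp_le: "exp (n * (s\<^sup>2 * (V / b) - s * (E0 * t))) \<le> \<delta> / real n ^ (q + 2)" .
    have "2 * card T * exp (n * (s\<^sup>2 * (V / b) - s * (E0 * t))) \<le> 2 * (A4 * real n ^ q) * (\<delta> / real n ^ (q + 2))"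
      using card_T exp_le \<delta> by (intro mult_mono) auto
    also have "\<dots> = \<delta> * (2 * A4 / real n ^ 2)" using n3 by (simp add: power_add field_simps power2_eq_square)
    also have "\<dots> \<le> \<delta> * 1"
    proof -
      have "real n * 1 \<le> real n * real n" using n3 by (intro mult_left_mono) auto
      then have "2 * A4 \<le> real n ^ 2" using n3(2) unfolding power2_eq_square by linarith
      then show ?thesis using n3 \<delta> by (intro mult_left_mono) (auto simp: divide_le_eq)
    qed
    finally have prob_E: "1 - \<delta> \<le> M.prob E" using E(2) by simp
    have dev: "E0 * t + 2 * (\<eta>0 / n) \<le> H * t"
    proof -
      have "\<eta>0 * (1 / n) \<le> \<eta>0 * t" using t_ge kernel_consts by (intro mult_left_mono) (auto simp: \<eta>0_def)
      then show ?thesis by (simp add: H_def distrib_right)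
    qed
    have "\<bar>(\<Sum>i=1..n. \<kappa>Z hZ z (Zs i \<omega>)) / n - expectation (\<lambda>\<omega>. \<kappa>Z hZ z (Z \<omega>))\<bar> \<le> H * t"
      if "\<omega> \<in> E" "z \<in> \<Z>" for \<omega> z
      using E(3)[OF that(1), of "f1 z"] that(2) dev f1_int[OF that(2)] by (simp add: F_def f1_def)
    moreover have "\<bar>(\<Sum>i=1..n. \<kappa>Z hZ z (Zs i \<omega>) * ?Y hU (Ds i \<omega>) u) / n
            - expectation (\<lambda>\<omega>. \<kappa>Z hZ z (Z \<omega>) * ?Y hU (D \<omega>) u)\<bar> \<le> H * t"
      if "\<omega> \<in> E" "z \<in> \<Z>" "u \<in> Omega_bar L" for \<omega> z u
    proof -
      have "f2 z u \<in> F" using that by (auto simp: F_def)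
      from E(3)[OF that(1) this] dev f2_int[OF that(2,3)] show ?thesis by (simp add: f2_def)
    qed
    ultimately have "\<exists>E\<in>sets M. 1 - \<delta> \<le> measure M E \<and> (\<forall>\<omega>\<in>E. \<forall>z\<in>\<Z>.
        \<bar>(\<Sum>i=1..n. \<kappa>Z hZ z (Zs i \<omega>)) / n - expectation (\<lambda>\<omega>. \<kappa>Z hZ z (Z \<omega>))\<bar> \<le> H * t \<and>
        (\<forall>u\<in>Omega_bar L.
          \<bar>(\<Sum>i=1..n. \<kappa>Z hZ z (Zs i \<omega>) * ?Y hU (Ds i \<omega>) u) / n
            - expectation (\<lambda>\<omega>. \<kappa>Z hZ z (Z \<omega>) * ?Y hU (D \<omega>) u)\<bar> \<le> H * t))"
      using E(1) prob_E by blast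
  }
  with H show thesis by (rule that)
qed

end

section \<open>Rates and moduli of continuity\<close>

text \<open>Let \<open>b = hZ\<^sup>d hU\<^sup>2\<close>. Since \<open>n b / ln n \<rightarrow> \<infinity>\<close>, eventually \<open>b \<ge> 1 / n\<close>. Hence the logarithm in the rate is at most
  \<open>ln (C n\<^sup>2 / \<delta>) = O (ln n)\<close>, which is negligible against \<open>n b\<close>.\<close>

lemma bandwidths_asymptotics:
  assumes bw: "bandwidths d hZ hU" and \<delta>: "0 < \<delta>" "\<delta> < 1" and C: "1 \<le> C"
  shows "\<forall>\<^sub>F n in sequentially. 1 \<le> real n * hZ n ^ d * (hU n)\<^sup>2"
    and "\<forall>\<^sub>F n in sequentially. 0 < ln (C * real n / (\<delta> * hZ n ^ d * (hU n)\<^sup>2))"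
    and "(\<lambda>n. ln (C * real n / (\<delta> * hZ n ^ d * (hU n)\<^sup>2)) / (real n * hZ n ^ d * (hU n)\<^sup>2)) \<longlonglongrightarrow> 0"
proof -
  define b where "b n = hZ n ^ d * (hU n)\<^sup>2" for n
  have pos: "0 < hZ n" "0 < hU n" if "1 \<le> n" for n using bw that by (auto simp: bandwidths_def)
  have lim: "hZ \<longlonglongrightarrow> 0" "hU \<longlonglongrightarrow> 0"
    and top: "filterlim (\<lambda>n. real n * b n / ln (real n)) at_top sequentially"
    using bw by (auto simp: bandwidths_def b_def mult.assoc)
  have ev: "\<forall>\<^sub>F n in sequentially. 3 \<le> n \<and> hZ n \<le> 1 \<and> hU n \<le> 1 \<and> 1 \<le> real n * b n / ln (real n)"
    using eventually_ge_at_top[of 3] order_tendstoD(2)[OF lim(1) zero_less_one]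
      order_tendstoD(2)[OF lim(2) zero_less_one]
      top[unfolded filterlim_at_top, rule_format, of 1]
    by eventually_elim auto
  have facts: "\<forall>\<^sub>F n in sequentially. 3 \<le> n \<and> 1 \<le> ln (real n) \<and> 1 \<le> real n * b n \<and> 0 < b n \<and> b n \<le> 1"
    using ev
  proof eventually_elim
    case (elim n)
    have l: "1 \<le> ln (real n)" using elim exp_le by (subst ln_ge_iff) auto
    have "ln (real n) \<le> real n * b n" using elim l by (simp add: le_divide_eq)
    moreover have "0 < b n" "b n \<le> 1" using elim pos[of n] by (auto simp: b_def mult_le_one power_le_one)
    ultimately show ?case using l elim by simp
  qed
  let ?l = "\<lambda>n. ln (C * real n / (\<delta> * b n))"
  have l_bounds: "\<forall>\<^sub>F n in sequentially. 1 \<le> ?l n \<and> ?l n \<le> (\<bar>ln (C / \<delta>)\<bar> + 2) * ln (real n)"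
    using facts
  proof eventually_elim
    case (elim n)
    have "real n \<le> C * real n / (\<delta> * b n)"
    proof -
      have "\<delta> * b n \<le> 1" "0 < \<delta> * b n" using elim \<delta> by (auto simp: mult_le_one)
      moreover have "real n * (\<delta> * b n) \<le> real n * 1" "1 * real n \<le> C * real n"
        using mult_right_mono[OF C, of "real n"] mult_left_mono[OF \<open>\<delta> * b n \<le> 1\<close>, of "real n"] by simp_all
      then have "real n * (\<delta> * b n) \<le> C * real n" by simp
      ultimately show ?thesis using \<open>0 < \<delta> * b n\<close> by (simp add: le_divide_eq)
    qed
    then have "ln (real n) \<le> ?l n" using elim by (intro ln_mono) auto
    moreover have "?l n \<le> ln (C / \<delta> * (real n * real n))"
    proof (rule ln_mono)
      have "1 / b n \<le> real n" using elim by (simp add: divide_le_eq)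
      then have "C * real n / \<delta> * (1 / b n) \<le> C * real n / \<delta> * real n"
        using C \<delta> by (intro mult_left_mono) auto
      then show "C * real n / (\<delta> * b n) \<le> C / \<delta> * (real n * real n)" by simp
    qed (use elim C \<delta> in auto)
    moreover have "ln (C / \<delta> * (real n * real n)) = ln (C / \<delta>) + 2 * ln (real n)"
      using elim C \<delta> ln_mult[of "C / \<delta>" "real n * real n"] ln_mult[of "real n" "real n"] by simp
    moreover have "ln (C / \<delta>) \<le> \<bar>ln (C / \<delta>)\<bar> * ln (real n)"
    proof -
      have "ln (C / \<delta>) \<le> \<bar>ln (C / \<delta>)\<bar> * 1" by simp
      also have "\<dots> \<le> \<bar>ln (C / \<delta>)\<bar> * ln (real n)" using elim by (intro mult_left_mono) auto
      finally show ?thesis .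
    qed
    ultimately show ?case using elim by (simp add: distrib_right)
  qed
  show "\<forall>\<^sub>F n in sequentially. 1 \<le> real n * hZ n ^ d * (hU n)\<^sup>2"
    using facts by eventually_elim (simp add: b_def mult.assoc)
  show "\<forall>\<^sub>F n in sequentially. 0 < ln (C * real n / (\<delta> * hZ n ^ d * (hU n)\<^sup>2))"
    using l_bounds by eventually_elim (simp add: b_def mult.assoc)
  have "(\<lambda>n. (\<bar>ln (C / \<delta>)\<bar> + 2) * inverse (real n * b n / ln (real n))) \<longlonglongrightarrow> (\<bar>ln (C / \<delta>)\<bar> + 2) * 0"
    by (intro tendsto_mult tendsto_const filterlim_compose[OF tendsto_inverse_0_at_top top] top tendsto_inverse_0_at_top)
  then have up: "(\<lambda>n. (\<bar>ln (C / \<delta>)\<bar> + 2) * inverse (real n * b n / ln (real n))) \<longlonglongrightarrow> 0" by simp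
  have "(\<lambda>n. ?l n / (real n * b n)) \<longlonglongrightarrow> 0"
  proof (rule tendsto_sandwich[OF _ _ tendsto_const up])
    show "\<forall>\<^sub>F n in sequentially. 0 \<le> ?l n / (real n * b n)"
      using l_bounds facts by eventually_elim auto
    show "\<forall>\<^sub>F n in sequentially. ?l n / (real n * b n) \<le> (\<bar>ln (C / \<delta>)\<bar> + 2) * inverse (real n * b n / ln (real n))"
      using l_bounds facts
    proof eventually_elim
      case (elim n)
      then have "?l n / (real n * b n) \<le> (\<bar>ln (C / \<delta>)\<bar> + 2) * ln (real n) / (real n * b n)"
        by (intro divide_right_mono) auto
      then show ?case by (simp add: inverse_eq_divide)
    qed
  qed
  then show "(\<lambda>n. ln (C * real n / (\<delta> * hZ n ^ d * (hU n)\<^sup>2)) / (real n * hZ n ^ d * (hU n)\<^sup>2)) \<longlonglongrightarrow> 0"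
    by (simp add: b_def mult.assoc)
qed

lemma rate_tendsto_0:
  assumes bw: "bandwidths d hZ hU" and \<delta>: "0 < \<delta>" "\<delta> < 1" and C: "1 \<le> C"
  shows "(\<lambda>n. rate C d n (hZ n) (hU n) \<delta>) \<longlonglongrightarrow> 0"
  using tendsto_add[OF tendsto_real_sqrt[OF bandwidths_asymptotics(3)[OF assms]] bandwidths_asymptotics(3)[OF assms]]
  by (simp add: rate_def Let_def)

lemma le_modulus:
  fixes f :: "'a::real_normed_vector \<Rightarrow> 'b::real_normed_vector \<Rightarrow> real"
  assumes bdd: "\<And>z u. z \<in> A \<Longrightarrow> u \<in> B \<Longrightarrow> \<bar>f z u\<bar> \<le> m"
    and "z \<in> A" "z' \<in> A" "u \<in> B" "u' \<in> B" "norm (z - z') + norm (u - u') \<le> r"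
  shows "\<bar>f z u - f z' u'\<bar> \<le> modulus A B f r"
  unfolding modulus_def
proof (rule cSup_upper)
  show "bdd_above {\<bar>f z u - f z' u'\<bar> |z u z' u'. z \<in> A \<and> z' \<in> A \<and> u \<in> B \<and> u' \<in> B \<and> norm (z - z') + norm (u - u') \<le> r}"
  proof (rule bdd_aboveI[of _ "2 * m"], clarify)
    fix z u z' u' assume "z \<in> A" "z' \<in> A" "u \<in> B" "u' \<in> B"
    then show "\<bar>f z u - f z' u'\<bar> \<le> 2 * m" using bdd[of z u] bdd[of z' u'] by linarith
  qed
qed (use assms in blast)

lemma modulus_tendsto_0:
  fixes f :: "'a::real_normed_vector \<Rightarrow> 'b::real_normed_vector \<Rightarrow> real"
  assumes bdd: "\<And>z u. z \<in> A \<Longrightarrow> u \<in> B \<Longrightarrow> \<bar>f z u\<bar> \<le> m"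
    and ne: "A \<noteq> {}" "B \<noteq> {}"
    and uc: "uniformly_continuous_on (A \<times> B) (\<lambda>(z, u). f z u)"
    and r: "r \<longlonglongrightarrow> 0" "\<forall>\<^sub>F n in sequentially. 0 \<le> r n"
  shows "(\<lambda>n. modulus A B f (r n)) \<longlonglongrightarrow> 0"
proof (rule tendstoI)
  fix e :: real assume e: "0 < e"
  obtain d where d: "0 < d" "\<And>x x'. x \<in> A \<times> B \<Longrightarrow> x' \<in> A \<times> B \<Longrightarrow> dist x' x < d \<Longrightarrow>
      dist (case x' of (z, u) \<Rightarrow> f z u) (case x of (z, u) \<Rightarrow> f z u) < e / 2"
    using uc e unfolding uniformly_continuous_on_def by (meson half_gt_zero)
  obtain a b where ab: "a \<in> A" "b \<in> B" using ne by auto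
  show "\<forall>\<^sub>F n in sequentially. dist (modulus A B f (r n)) 0 < e"
    using r(2) order_tendstoD(2)[OF r(1) d(1)]
  proof eventually_elim
    case (elim n)
    let ?S = "{\<bar>f z u - f z' u'\<bar> |z u z' u'. z \<in> A \<and> z' \<in> A \<and> u \<in> B \<and> u' \<in> B \<and> norm (z - z') + norm (u - u') \<le> r n}"
    have "modulus A B f (r n) \<le> e / 2"
      unfolding modulus_def
    proof (rule cSup_least)
      have "\<bar>f a b - f a b\<bar> \<in> ?S" using ab elim by force
      then show "?S \<noteq> {}" by blast
      fix y assume "y \<in> ?S"
      then obtain z u z' u' where y: "y = \<bar>f z u - f z' u'\<bar>" "z \<in> A" "z' \<in> A" "u \<in> B" "u' \<in> B"
        "norm (z - z') + norm (u - u') \<le> r n" by blast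
      have "dist (z, u) (z', u') \<le> norm (z - z') + norm (u - u')"
        using norm_Pair_le[of "z - z'" "u - u'"] by (simp add: dist_norm)
      then have "dist (z, u) (z', u') < d" using y elim by simp
      from d(2)[OF _ _ this] y show "y \<le> e / 2" by (simp add: dist_real_def)
    qed
    moreover have "0 \<le> modulus A B f (r n)"
      using le_modulus[OF bdd ab(1) ab(1) ab(2) ab(2), where r = "r n"] elim by simp
    ultimately show ?case using e by (simp add: dist_real_def)
  qed
qed

text \<open>The exceptional set of level \<open>\<delta>\<close> eventually contains the event of a large error. The outer
  measure takes the place of the probability, as the errors of interest are suprema over uncountable
  sets, which may fail to be measurable.\<close>

lemma tendsto_in_probability:
  fixes err :: "nat \<Rightarrow> 'm \<Rightarrow> ereal" and bound :: "real \<Rightarrow> nat \<Rightarrow> real"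
  assumes M: "prob_space M"
    and hp: "\<And>\<delta>. 0 < \<delta> \<Longrightarrow> \<delta> < 1 \<Longrightarrow> \<forall>\<^sub>F n in sequentially. \<exists>E\<in>sets M. 1 - \<delta> \<le> measure M E \<and>
      (\<forall>\<omega>\<in>E. err n \<omega> \<le> ereal (bound \<delta> n))"
    and bound: "\<And>\<delta>. 0 < \<delta> \<Longrightarrow> \<delta> < 1 \<Longrightarrow> bound \<delta> \<longlonglongrightarrow> 0" and \<epsilon>: "0 < \<epsilon>"
  shows "(\<lambda>n. outer_measure_of M {\<omega> \<in> space M. ereal \<epsilon> < err n \<omega>}) \<longlonglongrightarrow> 0"
proof (rule order_tendstoI)
  interpret prob_space M by (rule M)
  fix a :: ennreal assume a: "0 < a"
  obtain \<delta> where \<delta>: "0 < \<delta>" "\<delta> < 1" "ennreal \<delta> < a"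
  proof -
    obtain x where x: "0 < x" "x < min a 1" using dense[of 0 "min a 1"] a by auto
    then have "x < top" by (auto intro: less_trans)
    then obtain d where "x = ennreal d" "0 \<le> d" by (cases x) auto
    then show thesis using x that[of d] by (auto simp: ennreal_less_iff[of _ 1, simplified])
  qed
  show "\<forall>\<^sub>F n in sequentially. outer_measure_of M {\<omega> \<in> space M. ereal \<epsilon> < err n \<omega>} < a"
    using hp[OF \<delta>(1,2)] order_tendstoD(2)[OF bound[OF \<delta>(1,2)] \<epsilon>]
  proof eventually_elim
    case (elim n)
    then obtain E where E: "E \<in> events" "1 - \<delta> \<le> prob E" "\<And>\<omega>. \<omega> \<in> E \<Longrightarrow> err n \<omega> \<le> ereal (bound \<delta> n)" by blast
    have "{\<omega> \<in> space M. ereal \<epsilon> < err n \<omega>} \<subseteq> space M - E"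
    proof safe
      fix \<omega> assume "\<omega> \<in> E" "ereal \<epsilon> < err n \<omega>"
      then have "ereal \<epsilon> < ereal (bound \<delta> n)" using E(3) by (meson order_less_le_trans)
      then show False using elim by simp
    qed
    then have "outer_measure_of M {\<omega> \<in> space M. ereal \<epsilon> < err n \<omega>} \<le> outer_measure_of M (space M - E)"
      by (rule outer_measure_of_mono)
    also have "\<dots> = ennreal (prob (space M - E))"
      using E(1) by (simp add: emeasure_eq_measure)
    also have "\<dots> \<le> ennreal \<delta>" using E by (intro ennreal_leI) (simp add: prob_compl)
    also have "\<dots> < a" by (rule \<delta>)
    finally show ?case .
  qed
qed simp

section \<open>Uniform consistency of the intensity estimator\<close>

text \<open>Write \<open>G - l S = (G - EG) - l (S - ES) + (EG - l ES)\<close>, and divide by \<open>S \<ge> c / 2\<close>.\<close>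

lemma ratio_error:
  fixes G S EG ES :: real
  assumes G: "\<bar>G - EG\<bar> \<le> \<Delta>" and S: "\<bar>S - ES\<bar> \<le> \<Delta>" and bias: "\<bar>EG - l * ES\<bar> \<le> \<beta>"
    and c: "0 < c" "c \<le> ES" "\<Delta> \<le> c / 2" and l: "0 \<le> l" "l \<le> m"
  shows "\<bar>G / S - l\<bar> \<le> 2 / c * (\<Delta> * (1 + m) + \<beta>)"
proof -
  have S0: "c / 2 \<le> S" using S c by linarith
  have "\<Delta> \<ge> 0" using G by linarith
  have "G - l * S = (G - EG) - l * (S - ES) + (EG - l * ES)" by (simp add: algebra_simps)
  then have "\<bar>G - l * S\<bar> \<le> \<bar>G - EG\<bar> + \<bar>l * (S - ES)\<bar> + \<bar>EG - l * ES\<bar>" by linarith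
  also have "\<bar>l * (S - ES)\<bar> \<le> m * \<Delta>"
    unfolding abs_mult using S l by (intro mult_mono) auto
  finally have num: "\<bar>G - l * S\<bar> \<le> \<Delta> * (1 + m) + \<beta>" using G bias by (simp add: algebra_simps)
  have "G / S - l = (G - l * S) / S" using S0 c by (simp add: field_simps)
  then have "\<bar>G / S - l\<bar> = \<bar>G - l * S\<bar> / S" using S0 c by (simp add: abs_divide)
  also have "\<dots> \<le> (\<Delta> * (1 + m) + \<beta>) / (c / 2)"
    using num S0 c by (intro frac_le) auto
  finally show ?thesis by (simp add: mult.commute)
qed

context intensity_model
begin

lemma bias_le_modulus:
  assumes hZ: "0 < hZ" "hZ \<le> h0" and hU: "0 < hU" "hU \<le> h0" and z: "z \<in> \<Z>" and u: "u \<in> Omega_bar L"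
  shows "\<bar>expectation (\<lambda>\<omega>. \<kappa>Z hZ z (Z \<omega>) * smoothed_diagram L w KU hU (D \<omega>) u)
      - lam z u * expectation (\<lambda>\<omega>. \<kappa>Z hZ z (Z \<omega>))\<bar> \<le> CZ * modulus \<Z> (Omega_bar L) lam (hZ + hU)"
proof -
  let ?m = "modulus \<Z> (Omega_bar L) lam (hZ + hU)"
  let ?ES = "expectation (\<lambda>\<omega>. \<kappa>Z hZ z (Z \<omega>))"
  have bdd: "\<bar>lam z u\<bar> \<le> lmax" if "z \<in> \<Z>" "u \<in> Omega_bar L" for z u
    using lam_nonneg[OF that] lam_le[OF that] by simp
  have near: "\<bar>lam z' u' - lam z u\<bar> \<le> ?m"
    if "z' \<in> \<Z>" "u' \<in> Omega_bar L" "norm (z' - z) \<le> hZ" "norm (u' - u) \<le> hU" for z' u'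
    using that z u by (intro le_modulus[where m = lmax] bdd) auto
  have m0: "0 \<le> ?m" using near[OF z u] hZ hU by simp
  have ES: "0 \<le> ?ES" "?ES \<le> CZ" using expectation_kernel(1,2)[OF hZ z] cZ by auto
  have ESm: "?m * ?ES \<le> CZ * ?m" using mult_left_mono[OF ES(2) m0] by (simp add: mult.commute)
  have mm: "max 0 (lam z u - ?m) \<le> lam z' u' \<and> lam z' u' \<le> lam z u + ?m"
    if "z' \<in> \<Z>" "u' \<in> Omega_bar L" "norm (z' - z) \<le> hZ" "norm (u' - u) \<le> hU" for z' u'
    using near[OF that] lam_nonneg[OF that(1,2)] by auto
  note e = expectation_product_bounds[OF hZ hU z u, of "max 0 (lam z u - ?m)" "lam z u + ?m", OF _ mm]
  have "(lam z u - ?m) * ?ES \<le> max 0 (lam z u - ?m) * ?ES" using ES by (intro mult_right_mono) auto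
  with e ESm show ?thesis by (simp add: abs_le_iff algebra_simps)
qed

text \<open>The deviation bound is applied with \<open>t = sqrt (l / N)\<close>, the leading term of the rate. It tends to
  \<open>0\<close>, so eventually the denominator deviates from its mean, which is at least \<open>cZ\<close>, by at most
  \<open>cZ / 2\<close>.\<close>

lemma sup_error_high_probability:
  obtains C where "1 \<le> C" and
    "\<And>(M::'m measure) Zs Ds hZ hU \<delta>.
     iid_copies P (borel \<Otimes>\<^sub>M diagram_space L) (\<lambda>\<omega>. (Z \<omega>, D \<omega>)) M (\<lambda>i \<omega>. (Zs i \<omega>, Ds i \<omega>)) \<Longrightarrow>
     bandwidths CARD('d) hZ hU \<Longrightarrow> 0 < \<delta> \<Longrightarrow> \<delta> < 1 \<Longrightarrow>
     (\<forall>\<^sub>F n in sequentially. \<exists>E\<in>sets M. 1 - \<delta> \<le> measure M E \<and>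
        (\<forall>\<omega>\<in>E. sup_error \<Z> (Omega_bar L)
            (intensity_estimator L w \<Z> KZ KU (hZ n) (hU n) n (\<lambda>i. Zs i \<omega>) (\<lambda>i. Ds i \<omega>)) lam
          \<le> ereal (C * (modulus \<Z> (Omega_bar L) lam (hZ n + hU n) + rate C CARD('d) n (hZ n) (hU n) \<delta>))))"
proof -
  let ?d = "CARD('d)"
  obtain H N0 where H: "0 < H" and dev: "\<And>(M::'m measure) Zs Ds n hZ hU \<delta> t.
     iid_copies P (borel \<Otimes>\<^sub>M diagram_space L) (\<lambda>\<omega>. (Z \<omega>, D \<omega>)) M (\<lambda>i \<omega>. (Zs i \<omega>, Ds i \<omega>)) \<Longrightarrow>
     N0 \<le> n \<Longrightarrow> 0 < hZ \<Longrightarrow> hZ \<le> h0 \<Longrightarrow> 0 < hU \<Longrightarrow> hU \<le> h0 \<Longrightarrow>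
     1 \<le> real n * hZ ^ ?d * hU\<^sup>2 \<Longrightarrow> 0 < \<delta> \<Longrightarrow> \<delta> < 1 \<Longrightarrow> 0 < t \<Longrightarrow> t \<le> 1 \<Longrightarrow>
     ln (real n / (\<delta> * hZ ^ ?d * hU\<^sup>2)) \<le> t\<^sup>2 * (real n * hZ ^ ?d * hU\<^sup>2) \<Longrightarrow>
     (\<exists>E\<in>sets M. 1 - \<delta> \<le> measure M E \<and> (\<forall>\<omega>\<in>E. \<forall>z\<in>\<Z>.
        \<bar>(\<Sum>i=1..n. \<kappa>Z hZ z (Zs i \<omega>)) / n - expectation (\<lambda>\<omega>. \<kappa>Z hZ z (Z \<omega>))\<bar> \<le> H * t \<and>
        (\<forall>u\<in>Omega_bar L.
          \<bar>(\<Sum>i=1..n. \<kappa>Z hZ z (Zs i \<omega>) * smoothed_diagram L w KU hU (Ds i \<omega>) u) / n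
            - expectation (\<lambda>\<omega>. \<kappa>Z hZ z (Z \<omega>) * smoothed_diagram L w KU hU (D \<omega>) u)\<bar> \<le> H * t)))"
    by (fact kernel_averages_deviation)
  obtain z1 where z1: "z1 \<in> \<Z>" using \<Z>_nonempty by auto
  have CZ: "0 < CZ" using z1 pZ cZ by fastforce
  define lm where "lm = max lmax 0"
  have lm: "0 \<le> lm" "lmax \<le> lm" by (auto simp: lm_def)
  define C where "C = 1 + 2 / cZ * (H * (1 + lm) + CZ)"
  have pos: "0 \<le> H * (1 + lm)" "0 \<le> 2 / cZ" using H lm cZ by auto
  have C: "1 \<le> C" "2 / cZ * (H * (1 + lm)) \<le> C" "2 / cZ * CZ \<le> C"
    using pos CZ mult_nonneg_nonneg[OF pos(2,1)] mult_nonneg_nonneg[OF pos(2), of CZ]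
    by (auto simp: C_def distrib_left)
  {
    fix M :: "'m measure" and Zs Ds hZ hU and \<delta> :: real
    assume iid: "iid_copies P (borel \<Otimes>\<^sub>M diagram_space L) (\<lambda>\<omega>. (Z \<omega>, D \<omega>)) M (\<lambda>i \<omega>. (Zs i \<omega>, Ds i \<omega>))"
      and bw: "bandwidths ?d hZ hU" and \<delta>: "0 < \<delta>" "\<delta> < 1"
    have lim: "hZ \<longlonglongrightarrow> 0" "hU \<longlonglongrightarrow> 0" using bw by (auto simp: bandwidths_def)
    define N where "N n = real n * hZ n ^ ?d * (hU n)\<^sup>2" for n
    define l where "l n = ln (C * real n / (\<delta> * hZ n ^ ?d * (hU n)\<^sup>2))" for n
    define t where "t n = sqrt (l n / N n)" for n
    note asy = bandwidths_asymptotics[OF bw \<delta> C(1), folded N_def l_def]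
    have "t \<longlonglongrightarrow> 0" unfolding t_def using tendsto_real_sqrt[OF asy(3)] by simp
    moreover have "0 < min 1 (cZ / (2 * H))" using cZ H by simp
    ultimately have t_small: "\<forall>\<^sub>F n in sequentially. t n < min 1 (cZ / (2 * H))"
      by (rule order_tendstoD(2))
    have "\<forall>\<^sub>F n in sequentially. \<exists>E\<in>sets M. 1 - \<delta> \<le> measure M E \<and>
        (\<forall>\<omega>\<in>E. sup_error \<Z> (Omega_bar L)
            (intensity_estimator L w \<Z> KZ KU (hZ n) (hU n) n (\<lambda>i. Zs i \<omega>) (\<lambda>i. Ds i \<omega>)) lam
          \<le> ereal (C * (modulus \<Z> (Omega_bar L) lam (hZ n + hU n) + rate C ?d n (hZ n) (hU n) \<delta>)))"
      using asy(1,2) t_small eventually_ge_at_top[of "max 1 N0"]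
        order_tendstoD(2)[OF lim(1) kernel_consts(2)] order_tendstoD(2)[OF lim(2) kernel_consts(2)]
    proof eventually_elim
      case (elim n)
      have n: "1 \<le> n" "N0 \<le> n" using elim by auto
      have hZ: "0 < hZ n" "hZ n \<le> h0" and hU: "0 < hU n" "hU n \<le> h0"
        using bw elim n by (auto simp: bandwidths_def)
      have t: "0 < t n" "t n \<le> 1" "H * t n \<le> cZ / 2" "(t n)\<^sup>2 * N n = l n" "t n \<le> rate C ?d n (hZ n) (hU n) \<delta>"
      proof -
        show "0 < t n" using elim by (simp add: t_def)
        show "t n \<le> 1" using elim by simp
        have "t n \<le> cZ / (2 * H)" using elim by simp
        then show "H * t n \<le> cZ / 2" using H by (simp add: field_simps)
        show "(t n)\<^sup>2 * N n = l n" using elim by (simp add: t_def)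
        have "rate C ?d n (hZ n) (hU n) \<delta> = t n + l n / N n"
          by (simp add: rate_def Let_def t_def l_def N_def)
        then show "t n \<le> rate C ?d n (hZ n) (hU n) \<delta>" using elim by simp
      qed
      have ln_le: "ln (real n / (\<delta> * hZ n ^ ?d * (hU n)\<^sup>2)) \<le> (t n)\<^sup>2 * (real n * hZ n ^ ?d * (hU n)\<^sup>2)"
      proof -
        have "ln (real n / (\<delta> * hZ n ^ ?d * (hU n)\<^sup>2)) \<le> l n"
          unfolding l_def using n hZ hU \<delta> C(1)
          by (intro ln_mono divide_right_mono) (auto intro!: divide_pos_pos mult_pos_pos)
        then show ?thesis using t(4) by (simp add: N_def)
      qed
      let ?\<omega> = "modulus \<Z> (Omega_bar L) lam (hZ n + hU n)" and ?r = "rate C ?d n (hZ n) (hU n) \<delta>"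
      let ?est = "\<lambda>\<omega>. intensity_estimator L w \<Z> KZ KU (hZ n) (hU n) n (\<lambda>i. Zs i \<omega>) (\<lambda>i. Ds i \<omega>)"
      have "1 \<le> real n * hZ n ^ ?d * (hU n)\<^sup>2" using elim by (simp add: N_def)
      from dev[OF iid n(2) hZ hU this \<delta> t(1,2) ln_le]
      obtain E where E: "E \<in> sets M" "1 - \<delta> \<le> measure M E"
        and E1: "\<And>\<omega> z. \<omega> \<in> E \<Longrightarrow> z \<in> \<Z> \<Longrightarrow>
          \<bar>(\<Sum>i=1..n. \<kappa>Z (hZ n) z (Zs i \<omega>)) / n - expectation (\<lambda>\<omega>. \<kappa>Z (hZ n) z (Z \<omega>))\<bar> \<le> H * t n"
        and E2: "\<And>\<omega> z u. \<omega> \<in> E \<Longrightarrow> z \<in> \<Z> \<Longrightarrow> u \<in> Omega_bar L \<Longrightarrow>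
          \<bar>(\<Sum>i=1..n. \<kappa>Z (hZ n) z (Zs i \<omega>) * smoothed_diagram L w KU (hU n) (Ds i \<omega>) u) / n
            - expectation (\<lambda>\<omega>. \<kappa>Z (hZ n) z (Z \<omega>) * smoothed_diagram L w KU (hU n) (D \<omega>) u)\<bar> \<le> H * t n"
        by blast
      have "sup_error \<Z> (Omega_bar L) (?est \<omega>) lam \<le> ereal (C * (?\<omega> + ?r))" if \<omega>: "\<omega> \<in> E" for \<omega>
        unfolding sup_error_def
      proof (rule SUP_least, clarify)
        fix z u assume z: "z \<in> \<Z>" and u: "u \<in> Omega_bar L"
        let ?G = "(\<Sum>i=1..n. \<kappa>Z (hZ n) z (Zs i \<omega>) * smoothed_diagram L w KU (hU n) (Ds i \<omega>) u) / n"
        let ?S = "(\<Sum>i=1..n. \<kappa>Z (hZ n) z (Zs i \<omega>)) / n"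
        have est: "?est \<omega> z u = ?G / ?S" using n by (simp add: intensity_estimator_def)
        have b: "\<bar>?G / ?S - lam z u\<bar> \<le> 2 / cZ * (H * t n * (1 + lm) + CZ * ?\<omega>)"
          using lam_nonneg[OF z u] lam_le[OF z u] lm
          by (intro ratio_error[OF E2[OF \<omega> z u] E1[OF \<omega> z] bias_le_modulus[OF hZ hU z u] cZ
              expectation_kernel(1)[OF hZ z] t(3)]) auto
        have m0: "0 \<le> ?\<omega>"
          using order_trans[OF abs_ge_zero bias_le_modulus[OF hZ hU z u]] CZ
          by (simp add: zero_le_mult_iff)
        have "\<bar>?G / ?S - lam z u\<bar> \<le> 2 / cZ * (H * (1 + lm)) * t n + 2 / cZ * CZ * ?\<omega>"
        proof -
          have "2 / cZ * (H * t n * (1 + lm) + CZ * ?\<omega>) = 2 / cZ * (H * (1 + lm)) * t n + 2 / cZ * CZ * ?\<omega>"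
            by (simp add: algebra_simps add_divide_distrib)
          with b show ?thesis by (simp only:)
        qed
        also have "\<dots> \<le> C * ?r + C * ?\<omega>"
          using C t m0 by (intro add_mono mult_mono) auto
        finally show "ereal \<bar>?est \<omega> z u - lam z u\<bar> \<le> ereal (C * (?\<omega> + ?r))"
          unfolding est by (simp add: algebra_simps)
      qed
      then show ?case using E by blast
    qed
  }
  with C(1) show thesis by (rule that)
qed

end

theorem theorem4:
  fixes L :: real
    and P :: "'p measure"
    and Z :: "'p \<Rightarrow> real^'d"
    and D :: "'p \<Rightarrow> diagram"
    and w :: "real \<times> real \<Rightarrow> real"
    and \<Z> :: "(real^'d) set"
    and KZ :: "real^'d \<Rightarrow> real"
    and KU :: "real \<times> real \<Rightarrow> real"
    and \<rho>KZ \<rho>KU kZ kU \<rho>Z \<eta>Z cZ CZ :: real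
    and pZ :: "real^'d \<Rightarrow> real"
    and \<Lambda> :: "real^'d \<Rightarrow> (real \<times> real) measure"
    and lam :: "real^'d \<Rightarrow> real \<times> real \<Rightarrow> real"
  assumes L: "0 < L"
    and P: "prob_space P"
    and D: "D \<in> measurable P (diagram_space L)"
    and w_meas: "w \<in> borel_measurable (restrict_space borel (Omega_bar L))"
    and w_diag: "\<forall>x\<in>Delta L. w x = 0"
    and w_pos: "\<forall>x\<in>Omega L. 0 < w x"
    and mass: "AE \<omega> in P. 0 < emeasure (weighted_measure L w (D \<omega>)) (Omega_bar L) \<and>
                 emeasure (weighted_measure L w (D \<omega>)) (Omega_bar L) < \<infinity>"
    and KZ: "smoothing_kernel KZ \<rho>KZ kZ"
    and KU: "smoothing_kernel KU \<rho>KU kU"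
    and compact: "compact \<Z>"
    and cone_consts: "0 < \<rho>Z" "0 < \<eta>Z"
    and cone: "\<forall>z\<in>\<Z>. \<exists>\<xi>. norm \<xi> = 1 \<and>
                 {z + t *\<^sub>R v | t v. 0 < t \<and> t < \<rho>Z \<and> norm v = 1 \<and> norm (v - \<xi>) < \<eta>Z} \<subseteq> \<Z>"
    and Z: "distributed P lborel Z (\<lambda>z. ennreal (pZ z) * indicator \<Z> z)"
    and cZ: "0 < cZ"
    and pZ: "\<forall>z\<in>\<Z>. cZ \<le> pZ z \<and> pZ z \<le> CZ"
    and \<Lambda>: "conditional_mean_measure P (restrict_space borel (Omega_bar L)) Z
               (\<lambda>\<omega>. normalized_measure L w (D \<omega>)) \<Lambda>"
    and lam_nonneg: "\<forall>z\<in>\<Z>. \<forall>u\<in>Omega_bar L. 0 \<le> lam z u"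
    and lam_density: "\<forall>z\<in>\<Z>. \<Lambda> z =
               density (restrict_space lborel (Omega_bar L)) (\<lambda>u. ennreal (lam z u))"
    and lam_bounded: "bounded ((\<lambda>(z, u). lam z u) ` (\<Z> \<times> Omega_bar L))"
    and lam_cont: "uniformly_continuous_on (\<Z> \<times> Omega_bar L) (\<lambda>(z, u). lam z u)"
  shows "\<exists>C>0. \<forall>(M :: 'm measure) Zs Ds hZ hU.
    iid_copies P (borel \<Otimes>\<^sub>M diagram_space L) (\<lambda>\<omega>. (Z \<omega>, D \<omega>))
      M (\<lambda>i \<omega>. (Zs i \<omega>, Ds i \<omega>)) \<and>
    bandwidths CARD('d) hZ hU \<longrightarrow>
    (let err = (\<lambda>n \<omega>. sup_error \<Z> (Omega_bar L)
                 (intensity_estimator L w \<Z> KZ KU (hZ n) (hU n) n (\<lambda>i. Zs i \<omega>) (\<lambda>i. Ds i \<omega>)) lam)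
     in (\<forall>\<delta>. 0 < \<delta> \<and> \<delta> < 1 \<longrightarrow>
           (\<forall>\<^sub>F n in sequentially. \<exists>E\<in>sets M. 1 - \<delta> \<le> measure M E \<and>
             (\<forall>\<omega>\<in>E. err n \<omega> \<le>
               ereal (C * (modulus \<Z> (Omega_bar L) lam (hZ n + hU n)
                           + rate C CARD('d) n (hZ n) (hU n) \<delta>))))) \<and>
        (\<forall>\<epsilon>>0. (\<lambda>n. outer_measure_of M {\<omega> \<in> space M. ereal \<epsilon> < err n \<omega>}) \<longlonglongrightarrow> 0))"
proof -
  obtain aZ rZ where balls_Z: "interior_balls \<Z> aZ rZ"
    using interior_balls_cone[OF cone_consts cone] by blast
  obtain aU rU where balls_U: "interior_balls (Omega_bar L) aU rU"
    using interior_balls_Omega_bar[OF L] by blast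
  obtain A1 h1 where b1: "kernel_bounds \<Z> KZ A1 h1"
    using kernel_bounds_exist[OF KZ compact balls_Z] by blast
  obtain A2 h2 where b2: "kernel_bounds (Omega_bar L) KU A2 h2"
    using kernel_bounds_exist[OF KU compact_Omega_bar balls_U] by blast
  define A h0 where "A = max A1 A2" and "h0 = min h1 h2"
  have h0: "0 < h0" using b1 b2 by (auto simp: h0_def kernel_bounds_def)
  obtain lmax where lmax: "\<And>z u. z \<in> \<Z> \<Longrightarrow> u \<in> Omega_bar L \<Longrightarrow> \<bar>lam z u\<bar> \<le> lmax"
    using lam_bounded by (force simp: bounded_iff)
  interpret prob_space P by (rule P)
  interpret intensity_model P L Z D w \<Z> KZ KU pZ \<Lambda> lam A h0 cZ CZ lmax
  proof
    show "kernel_bounds \<Z> KZ A h0" "kernel_bounds (Omega_bar L) KU A h0"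
      using h0 by (auto intro: kernel_bounds_mono[OF b1] kernel_bounds_mono[OF b2] simp: A_def h0_def)
    show "lam z u \<le> lmax" if "z \<in> \<Z>" "u \<in> Omega_bar L" for z u using lmax[OF that] by simp
    show "continuous_on (\<Z> \<times> Omega_bar L) (\<lambda>(z, u). lam z u)"
      using lam_cont by (rule uniformly_continuous_imp_continuous)
  qed (use D w_meas compact Z cZ pZ \<Lambda> lam_nonneg lam_density in auto)
  obtain C where C: "1 \<le> C" and hp: "\<And>(M::'m measure) Zs Ds hZ hU \<delta>.
     iid_copies P (borel \<Otimes>\<^sub>M diagram_space L) (\<lambda>\<omega>. (Z \<omega>, D \<omega>)) M (\<lambda>i \<omega>. (Zs i \<omega>, Ds i \<omega>)) \<Longrightarrow>
     bandwidths CARD('d) hZ hU \<Longrightarrow> 0 < \<delta> \<Longrightarrow> \<delta> < 1 \<Longrightarrow>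
     (\<forall>\<^sub>F n in sequentially. \<exists>E\<in>sets M. 1 - \<delta> \<le> measure M E \<and>
        (\<forall>\<omega>\<in>E. sup_error \<Z> (Omega_bar L)
            (intensity_estimator L w \<Z> KZ KU (hZ n) (hU n) n (\<lambda>i. Zs i \<omega>) (\<lambda>i. Ds i \<omega>)) lam
          \<le> ereal (C * (modulus \<Z> (Omega_bar L) lam (hZ n + hU n) + rate C CARD('d) n (hZ n) (hU n) \<delta>))))"
    by (fact sup_error_high_probability)
  have "(0, 0) \<in> Omega_bar L" using L by (simp add: Omega_bar_def)
  then have ne: "Omega_bar L \<noteq> {}" by blast
  show ?thesis
  proof (intro exI[of _ C] conjI allI impI, goal_cases)
    case 1
    then show ?case using C by simp
  next
    case (2 M Zs Ds hZ hU)
    then have iid: "iid_copies P (borel \<Otimes>\<^sub>M diagram_space L) (\<lambda>\<omega>. (Z \<omega>, D \<omega>)) M (\<lambda>i \<omega>. (Zs i \<omega>, Ds i \<omega>))"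
      and bw: "bandwidths CARD('d) hZ hU" by auto
    have M: "prob_space M" using iid by (simp add: iid_copies_def)
    have "(\<lambda>n. hZ n + hU n) \<longlonglongrightarrow> 0 + 0" using bw by (intro tendsto_add) (auto simp: bandwidths_def)
    then have h_lim: "(\<lambda>n. hZ n + hU n) \<longlonglongrightarrow> 0" by simp
    have h_nn: "\<forall>\<^sub>F n in sequentially. 0 \<le> hZ n + hU n"
      using eventually_ge_at_top[of 1]
    proof eventually_elim
      case (elim n)
      then have "0 < hZ n" "0 < hU n" using bw by (auto simp: bandwidths_def)
      then show ?case by simp
    qed
    have mod_lim: "(\<lambda>n. modulus \<Z> (Omega_bar L) lam (hZ n + hU n)) \<longlonglongrightarrow> 0"
      using modulus_tendsto_0[OF lmax \<Z>_nonempty ne lam_cont h_lim h_nn] .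
    have bound_lim: "(\<lambda>n. C * (modulus \<Z> (Omega_bar L) lam (hZ n + hU n) + rate C CARD('d) n (hZ n) (hU n) \<delta>)) \<longlonglongrightarrow> 0"
      if "0 < \<delta>" "\<delta> < 1" for \<delta>
      using tendsto_mult[OF tendsto_const[of C] tendsto_add[OF mod_lim rate_tendsto_0[OF bw that C]]] by simp
    show ?case
      unfolding Let_def
    proof (intro conjI allI impI, goal_cases)
      case (1 \<delta>)
      then show ?case by (intro hp[OF iid bw]) auto
    next
      case (2 \<epsilon>)
      then show ?case by (intro tendsto_in_probability[OF M hp[OF iid bw] bound_lim])
    qed
  qed
qed

end
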